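(* Let $I=[0,1]$ and let $x$ be a non-negative Borel measure supported on $(0,1)$. Let $\phi_1,\dots,\phi_m$ be real-valued continuous functions on $I$, put $\Phi=(\phi_1,\dots,\phi_m)^T$, and assume $\Phi$ is $L$-Lipschitz: $\left\|\int_I\Phi(t)(x_1(dt)-x_2(dt))\right\|_2\le L\,d_{GW}(x_1,x_2)$ for all non-negative measures $x_1,x_2$ on $I$. Let $y_j=\int_I\phi_j(t)x(dt)+\delta_j$ with $\sum_{j=1}^m\delta_j^2\le\delta^2$. Let $\chi$ be a $k$-sparse non-negative discrete measure supported on $T=\{t_i\}_{i=1}^k\subset(0,1)$, let $0<\epsilon\le\Delta(T)/2$, and let $F$ and $F^\pi$ ($\pi\in\{\pm1\}^k$) be dual polynomial separators as in the context. Suppose $m\ge2k+2$ and that - $\{\phi_j\}_{j=1}^m$ form a T-system on $I$, - $\{F\}\cup\{\phi_j\}_{j=1}^m$ form a T*-system on $I$, and - $\{F^\pi\}\cup\{\phi_j\}_{j=1}^m$ form a T*-system on $I$ for every sign pattern $\pi\in\{\pm1\}^k$. Let $\delta'=\delta+L\,d_{GW}(x,\chi)$ and let $\hat x$ be any non-negative Borel measure on $I$ with $\|y-\int_I\Phi(t)\hat x(dt)\|_2\le\delta'$. Then there exist vectors $b\in\mathbb{R}^m$ and $b^\pi\in\mathbb{R}^m$ ($\pi\in\{\pm1\}^k$), such that $q=\sum_jb_j\phi_j$ satisfies $q\ge F$ on $I$ with equality on $T$, $q^\pi=\sum_jb_j^\pi\phi_j$ satisfies $q^\pi\ge F^\pi$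 on $I$ with equality on $T$, and $$d_{GW}(x,\hat x)\le\left(\Big(6+\frac2{\bar f}\Big)\|b\|_2+6\min_\pi\|b^\pi\|_2\right)\delta'+\epsilon\|\chi\|_{TV}+d_{GW}(x,\chi).$$
   Context: $\Delta(T)$ is the smallest distance between two distinct points of $T\cup\{0,1\}$. $T_{i,\epsilon}=\{t\in I:|t-t_i|\le\epsilon\}$, $T_\epsilon=\bigcup_iT_{i,\epsilon}$ (and similarly with $\rho$ in place of $\epsilon$). $\|z\|_{TV}=\int_I|z(dt)|$. For non-negative measures of equal mass, $d_W(z_1,z_2)=\inf_\gamma\int_{I\times I}|\tau_1-\tau_2|\,\gamma(d\tau_1,d\tau_2)$ over measures $\gamma$ on $I\times I$ with marginals $z_1,z_2$. $d_{GW}(x_1,x_2)=\inf_{z_1,z_2}\left(\|x_1-z_1\|_{TV}+d_W(z_1,z_2)+\|x_2-z_2\|_{TV}\right)$ over non-negative Borel measures $z_1,z_2$ on $I$ with $\|z_1\|_{TV}=\|z_2\|_{TV}$. T-system: continuous functions $\{\phi_j\}_{j=1}^m$ form a T-system on $I$ if $[\phi_j(\tau_l)]_{l,j=1}^m$ is nonsingular for every increasing sequence $\tau_1<\dots<\tau_m$ in $I$. T*-system (with respect to $T$): for even $m$, real-valued functions $\{\phi_j\}_{j=0}^m$ form a T*-system on $I=[0,1]$ if the following holds when $\rho>0$ is sufficiently small. For any increasing sequence $\tau=\{\tau_l\}_{l=0}^m\subset I$ such that (a) $\tau_0=0$, $\tau_m=1$; (b) except exactly three points, namely $\tau_0$,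 $\tau_m$ and one $\tau_{\underline l}\in(0,1)$, the other points belong to $T_\rho$; (c) every $T_{i,\rho}$ contains an even number of points; one has: (1) the determinant of the $(m+1)\times(m+1)$ matrix $M_\rho=[\phi_j(\tau_l)]_{l,j=0}^m$ is positive, and (2) the magnitudes of all minors of $M_\rho$ along the row containing $\tau_{\underline l}$ approach zero at the same rate as $\rho\to0$ (a function $u$ approaches zero at the rate $\rho^P$ when $u(\rho)=\Theta(\rho^P)$). In $\{F\}\cup\{\phi_j\}_{j=1}^m$ the function $F$ plays the role of $\phi_0$, and likewise for $F^\pi$. Dual polynomial separators: given a bounded $f:\mathbb{R}\to\mathbb{R}_+$ with $f(0)=0$ and positive constants $\bar f,f_0,f_1$, define $F(0)=f_0$, $F(1)=f_1$, $F(t)=f(t-t_i)$ if $t\in T_{i,\epsilon}$ for some $i$, and $F(t)=\bar f$ elsewhere on $(0,1)$; and $F^\pi(0)=f_0$, $F^\pi(1)=f_1$, $F^\pi(t)=\pi_i-f(t-t_i)$ if $t\in T_{i,\epsilon}$ for some $i$, and $F^\pi(t)=-\bar f$ elsewhere on $(0,1)$. *)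

theory Defs
  imports "HOL-Analysis.Analysis" "HOL-Library.Landau_Symbols" "Jordan_Normal_Form.Determinant"
begin

text \<open>
  Vectors in \<open>\<real>\<^sup>m\<close> and families \<open>\<phi>\<^sub>1, \<dots>, \<phi>\<^sub>m\<close> are functions on \<^typ>\<open>nat\<close> of which only
  the indices \<open>1, \<dots>, m\<close> matter; the Euclidean norm of \<open>b\<close> is \<open>L2_set b {1..m}\<close>.
  Likewise the points of \<open>T = {t\<^sub>1, \<dots>, t\<^sub>k}\<close> are given by \<open>t :: nat \<Rightarrow> real\<close>.
\<close>

abbreviation unit_I :: "real set" where
  "unit_I \<equiv> {0..1}"

abbreviation borel_I :: "real measure" where
  "borel_I \<equiv> restrict_space borel unit_I"


subsection \<open>Measures on the unit interval and their distances\<close>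

text \<open>As usual in this setting, non-negative measures are understood to have finite mass.\<close>

definition nonneg_measure_I :: "real measure \<Rightarrow> bool" where
  "nonneg_measure_I z \<longleftrightarrow> sets z = sets borel_I \<and> finite_measure z"

text \<open>
  The set \<open>S\<close> need not be closed: this only says that there is no mass outside \<open>S\<close>.
\<close>

definition supported_on :: "real measure \<Rightarrow> real set \<Rightarrow> bool" where
  "supported_on z S \<longleftrightarrow> emeasure z (space z - S) = 0"

text \<open>
  The total mass \<open>\<integral>|z(dt)|\<close> of the variation of a finite signed measure \<open>z\<close>, which is
  represented by its set function.
\<close>

definition tv_norm :: "(real set \<Rightarrow> real) \<Rightarrow> real" where
  "tv_norm z =
     (SUP P \<in> {P. finite P \<and> P \<subseteq> sets borel_I \<and> disjoint P \<and> \<Union>P = unit_I}. \<Sum>A\<in>P. \<bar>z A\<bar>)"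

definition couplings :: "real measure \<Rightarrow> real measure \<Rightarrow> (real \<times> real) measure set" where
  "couplings z1 z2 = {\<gamma>. sets \<gamma> = sets (borel_I \<Otimes>\<^sub>M borel_I) \<and>
     distr \<gamma> borel_I fst = z1 \<and> distr \<gamma> borel_I snd = z2}"

definition d_W :: "real measure \<Rightarrow> real measure \<Rightarrow> real" where
  "d_W z1 z2 = (INF \<gamma> \<in> couplings z1 z2. \<integral>p. \<bar>fst p - snd p\<bar> \<partial>\<gamma>)"

definition d_GW :: "real measure \<Rightarrow> real measure \<Rightarrow> real" where
  "d_GW x1 x2 =
     (INF (z1, z2) \<in> {(z1, z2). nonneg_measure_I z1 \<and> nonneg_measure_I z2 \<and>
                         tv_norm (measure z1) = tv_norm (measure z2)}.
        tv_norm (\<lambda>A. measure x1 A - measure z1 A) + d_W z1 z2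
          + tv_norm (\<lambda>A. measure x2 A - measure z2 A))"

definition lipschitz_GW :: "nat \<Rightarrow> (nat \<Rightarrow> real \<Rightarrow> real) \<Rightarrow> real \<Rightarrow> bool" where
  "lipschitz_GW m \<phi> L \<longleftrightarrow> (\<forall>x1 x2. nonneg_measure_I x1 \<and> nonneg_measure_I x2 \<longrightarrow>
     L2_set (\<lambda>j. (\<integral>s. \<phi> j s \<partial>x1) - (\<integral>s. \<phi> j s \<partial>x2)) {1..m} \<le> L * d_GW x1 x2)"


subsection \<open>The support set and its neighbourhoods\<close>

definition min_sep :: "real set \<Rightarrow> real" where
  "min_sep T = Min {\<bar>s - s'\<bar> | s s'. s \<in> T \<union> {0, 1} \<and> s' \<in> T \<union> {0, 1} \<and> s \<noteq> s'}"

definition nbhd :: "(nat \<Rightarrow> real) \<Rightarrow> real \<Rightarrow> nat \<Rightarrow> real set" where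
  "nbhd t \<rho> i = {s \<in> unit_I. \<bar>s - t i\<bar> \<le> \<rho>}"

definition nbhds :: "nat \<Rightarrow> (nat \<Rightarrow> real) \<Rightarrow> real \<Rightarrow> real set" where
  "nbhds k t \<rho> = (\<Union>i\<in>{1..k}. nbhd t \<rho> i)"


subsection \<open>Chebyshev systems\<close>

definition T_system :: "nat \<Rightarrow> (nat \<Rightarrow> real \<Rightarrow> real) \<Rightarrow> bool" where
  "T_system m \<phi> \<longleftrightarrow> (\<forall>j\<in>{1..m}. continuous_on unit_I (\<phi> j)) \<and>
     (\<forall>\<tau>. strict_mono_on {1..m} \<tau> \<and> \<tau> ` {1..m} \<subseteq> unit_I \<longrightarrow>
        Determinant.det (Matrix.mat m m (\<lambda>(l, j). \<phi> (Suc j) (\<tau> (Suc l)))) \<noteq> 0)"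

text \<open>
  Admissible node sequences \<open>\<tau>\<^sub>0 < \<dots> < \<tau>\<^sub>m\<close>; the index \<open>l\<close> is that of the exceptional
  interior node.
\<close>

definition admissible ::
  "nat \<Rightarrow> (nat \<Rightarrow> real) \<Rightarrow> nat \<Rightarrow> real \<Rightarrow> (nat \<Rightarrow> real) \<Rightarrow> nat \<Rightarrow> bool" where
  "admissible k t m \<rho> \<tau> l \<longleftrightarrow>
     strict_mono_on {0..m} \<tau> \<and> \<tau> ` {0..m} \<subseteq> unit_I \<and>
     \<tau> 0 = 0 \<and> \<tau> m = 1 \<and> l \<le> m \<and> \<tau> l \<in> {0<..<1} \<and>
     (\<forall>n\<in>{0..m}. \<tau> n \<notin> nbhds k t \<rho> \<longleftrightarrow> n \<in> {0, l, m}) \<and>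
     (\<forall>i\<in>{1..k}. even (card {n \<in> {0..m}. \<tau> n \<in> nbhd t \<rho> i}))"

definition node_mat :: "nat \<Rightarrow> (nat \<Rightarrow> real \<Rightarrow> real) \<Rightarrow> (nat \<Rightarrow> real) \<Rightarrow> real mat" where
  "node_mat m \<psi> \<tau> = Matrix.mat (Suc m) (Suc m) (\<lambda>(l, j). \<psi> j (\<tau> l))"

text \<open>
  In the second condition the nodes depend on \<open>\<rho>\<close>, and the minors along the exceptional row
  are required to share a common rate \<open>r(\<rho>) \<longlonglongrightarrow> 0\<close> for every choice of admissible nodes.  The
  rate is not required to be a power \<open>\<rho>\<^sup>P\<close>: admissible nodes within one neighbourhood may
  approach each other arbitrarily fast as \<open>\<rho>\<close> tends to 0, and then the minors, although
  comparable to each other, are smaller than any power of \<open>\<rho>\<close>.  Nodes for which the minors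
  are all of order \<open>\<rho>\<^sup>P\<close> with the same \<open>P > 0\<close> satisfy the condition, with \<open>r(\<rho>) = \<rho>\<^sup>P\<close>.
\<close>

definition T_star_system ::
  "nat \<Rightarrow> (nat \<Rightarrow> real) \<Rightarrow> nat \<Rightarrow> (nat \<Rightarrow> real \<Rightarrow> real) \<Rightarrow> bool" where
  "T_star_system k t m \<psi> \<longleftrightarrow> even m \<and>
     (\<forall>\<^sub>F \<rho> in at_right 0. \<forall>\<tau> l. admissible k t m \<rho> \<tau> l \<longrightarrow>
        Determinant.det (node_mat m \<psi> \<tau>) > 0) \<and>
     (\<forall>\<tau> l. (\<forall>\<^sub>F \<rho> in at_right 0. admissible k t m \<rho> (\<tau> \<rho>) l) \<longrightarrow>
        (\<exists>r :: real \<Rightarrow> real. (r \<longlongrightarrow> 0) (at_right 0) \<and>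
           (\<forall>j\<in>{0..m}. (\<lambda>\<rho>. \<bar>Determinant.det (mat_delete (node_mat m \<psi> (\<tau> \<rho>)) l j)\<bar>)
                           \<in> \<Theta>[at_right 0](r))))"


subsection \<open>Dual polynomial separators\<close>

text \<open>
  If \<open>\<epsilon>\<close> is half the minimal separation, two neighbouring intervals share an end point.
  There the index is an arbitrary but fixed choice, the same for both separators.
\<close>

definition nbhd_index :: "nat \<Rightarrow> (nat \<Rightarrow> real) \<Rightarrow> real \<Rightarrow> real \<Rightarrow> nat" where
  "nbhd_index k t \<epsilon> s = (SOME i. i \<in> {1..k} \<and> s \<in> nbhd t \<epsilon> i)"

definition sep_F ::
  "nat \<Rightarrow> (nat \<Rightarrow> real) \<Rightarrow> real \<Rightarrow> (real \<Rightarrow> real) \<Rightarrow> real \<Rightarrow> real \<Rightarrow> real \<Rightarrow> real \<Rightarrow> real" where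
  "sep_F k t \<epsilon> f fbar f0 f1 s =
     (if s = 0 then f0 else if s = 1 then f1
      else if s \<in> nbhds k t \<epsilon> then f (s - t (nbhd_index k t \<epsilon> s))
      else fbar)"

definition sep_F_sign ::
  "nat \<Rightarrow> (nat \<Rightarrow> real) \<Rightarrow> real \<Rightarrow> (real \<Rightarrow> real) \<Rightarrow> real \<Rightarrow> real \<Rightarrow> real \<Rightarrow> (nat \<Rightarrow> real)
     \<Rightarrow> real \<Rightarrow> real" where
  "sep_F_sign k t \<epsilon> f fbar f0 f1 \<pi> s =
     (if s = 0 then f0 else if s = 1 then f1
      else if s \<in> nbhds k t \<epsilon>
        then \<pi> (nbhd_index k t \<epsilon> s) - f (s - t (nbhd_index k t \<epsilon> s))
      else - fbar)"

definition sign_patterns :: "nat \<Rightarrow> (nat \<Rightarrow> real) set" where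
  "sign_patterns k = {1..k} \<rightarrow>\<^sub>E {-1, 1}"

end

theory Submission
  imports Defs "HOL-Complex_Analysis.Great_Picard"
begin

text \<open>
  The distance between \<open>x\<close> and \<open>x_hat\<close> is controlled by comparing \<open>x_hat\<close> with the atomic measure
  \<open>chi\<close>: both have nearly the same moments, and dual polynomials turn closeness of moments into
  closeness of masses.

  A generalised polynomial \<open>q\<close> in \<open>\<phi>\<^sub>1, \<dots>, \<phi>\<^sub>m\<close> with coefficient vector \<open>b\<close> satisfies
  \<open>\<integral>q dx_hat - \<integral>q dchi \<le> \<parallel>b\<parallel> \<cdot> 2\<delta>'\<close>, by Cauchy-Schwarz and the Lipschitz hypothesis
  (\<open>moment_discrepancy\<close>, \<open>gpoly_integral_difference\<close>).  If \<open>q \<ge> F\<close> with equality on \<open>T\<close>, then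
  \<open>q\<close> is non-negative, vanishes on \<open>T\<close> and is at least \<open>fbar\<close> off the neighbourhoods, so \<open>x_hat\<close> has mass
  at most \<open>2\<parallel>b\<parallel>\<delta>' / fbar\<close> there (\<open>off_support_mass\<close>).  The sum \<open>q + q\<^sup>\<pi>\<close> dominates the step
  function equal to \<open>\<pi>\<^sub>i\<close> on the \<open>i\<close>-th neighbourhood and agrees with it on \<open>T\<close>; with \<open>\<pi>\<close> the
  pattern of signs of the local mass differences, this bounds the sum of their absolute values by
  \<open>2(\<parallel>b\<parallel> + \<parallel>b\<^sup>\<pi>\<parallel>)\<delta>'\<close> (\<open>region_mass_difference\<close>).  Moving the mass of \<open>x_hat\<close> near \<open>t\<^sub>i\<close> to
  \<open>t\<^sub>i\<close> costs at most \<open>\<epsilon>\<close> per unit.  The triangle inequality for the distance is needed only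
  with the atomic measure \<open>chi\<close> in the middle, where couplings can be glued atom by atom
  (\<open>d_GW_through_atoms\<close>).

  The bound holds with \<open>\<parallel>b\<^sup>\<pi>\<parallel>\<close> for that particular \<open>\<pi>\<close>.  To reach the minimum over all patterns one
  replaces every \<open>q\<^sup>\<pi>\<close> by \<open>q\<^sup>\<pi> + c q\<close>: this keeps the domination and the equality on \<open>T\<close>, because
  \<open>q \<ge> 0\<close> vanishes on \<open>T\<close>, and for large \<open>c\<close> all norms exceed the original ones.

  The dual polynomials are limits of interpolants (\<open>T_star_limit_gpoly\<close>).  Put nodes at \<open>0\<close>, at \<open>1\<close>
  and in clusters of even size that begin at the points of \<open>T\<close> and have width less than \<open>\<rho>\<close>, and let
  \<open>q\<^sub>\<rho>\<close> interpolate \<open>F\<close> at these \<open>m\<close> nodes.  Inserting a further node \<open>s\<close> outside the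
  \<open>\<rho>\<close>-neighbourhoods of \<open>T\<close> gives an admissible sequence, whose determinant equals
  \<open>M (q\<^sub>\<rho>(s) - F(s))\<close>, where \<open>M\<close> is the T-system determinant of the \<open>m\<close> nodes; the sign is right because the new row has odd index.
  Hence \<open>q\<^sub>\<rho> > F\<close> off these neighbourhoods, if \<open>M > 0\<close>.  The coefficients of \<open>q\<^sub>\<rho>\<close> are quotients of minors,
  bounded by the common rate, and a subsequence converges as \<open>\<rho> \<rightarrow> 0\<close>.  The case \<open>M < 0\<close> is
  excluded by \<open>F\<^sup>\<pi>\<close>: the limit would be a continuous function below \<open>F\<^sup>\<pi>\<close>, thus at most \<open>-fbar\<close> near
  \<open>0\<close>, yet equal to \<open>f0 > 0\<close> at \<open>0\<close>.  If \<open>T\<close> is empty there are no clusters, and a large multiple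
  of a strictly positive polynomial serves instead (\<open>T_system_positive_gpoly\<close>).
\<close>

section \<open>Total variation on the unit interval\<close>

abbreviation partitions_I :: "real set set set" where
  "partitions_I \<equiv> {P. finite P \<and> P \<subseteq> sets borel_I \<and> disjoint P \<and> \<Union>P = unit_I}"

lemma space_nonneg_measure_I: "nonneg_measure_I z \<Longrightarrow> space z = unit_I"
  unfolding nonneg_measure_I_def by (metis sets_eq_imp_space_eq space_borel space_restrict_space2 Int_UNIV_right space_restrict_space)

lemma sets_nonneg_measure_I: "nonneg_measure_I z \<Longrightarrow> sets z = sets borel_I"
  unfolding nonneg_measure_I_def by simp

lemma finite_nonneg_measure_I: "nonneg_measure_I z \<Longrightarrow> finite_measure z"
  unfolding nonneg_measure_I_def by simp

lemma unit_I_in_partitions: "{unit_I} \<in> partitions_I"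
  by (auto simp: sets_restrict_space disjoint_def)

lemma sum_measure_partition:
  assumes "nonneg_measure_I z" "P \<in> partitions_I"
  shows "(\<Sum>A\<in>P. measure z A) = measure z unit_I"
proof -
  interpret finite_measure z using assms(1) by (rule finite_nonneg_measure_I)
  have "measure z (\<Union>A\<in>P. A) = (\<Sum>A\<in>P. measure z A)"
    using assms sets_nonneg_measure_I[OF assms(1)]
    by (intro finite_measure_finite_Union) (auto simp: disjoint_family_on_def disjoint_def)
  then show ?thesis using assms(2) by simp
qed

lemma tv_norm_leI:
  assumes "\<And>P. P \<in> partitions_I \<Longrightarrow> (\<Sum>A\<in>P. \<bar>z A\<bar>) \<le> c"
  shows "tv_norm z \<le> c"
  unfolding tv_norm_def by (intro cSUP_least assms) (use unit_I_in_partitions in blast)+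

lemma sum_partition_le_tv_norm:
  assumes "nonneg_measure_I z" "nonneg_measure_I w" "P \<in> partitions_I"
  shows "(\<Sum>A\<in>P. \<bar>measure z A - measure w A\<bar>) \<le> tv_norm (\<lambda>A. measure z A - measure w A)"
proof -
  have "(\<Sum>A\<in>P. \<bar>measure z A - measure w A\<bar>) \<le> measure z unit_I + measure w unit_I"
    if "P \<in> partitions_I" for P
  proof -
    have "(\<Sum>A\<in>P. \<bar>measure z A - measure w A\<bar>) \<le> (\<Sum>A\<in>P. measure z A + measure w A)"
      by (intro sum_mono) (smt (verit) measure_nonneg)
    then show ?thesis
      using sum_measure_partition[OF assms(1) that] sum_measure_partition[OF assms(2) that]
      by (simp add: sum.distrib)
  qed
  then show ?thesis
    unfolding tv_norm_def using assms(3)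
    by (intro cSUP_upper bdd_aboveI2) auto
qed

lemma tv_norm_diff_nonneg:
  assumes "nonneg_measure_I z" "nonneg_measure_I w"
  shows "0 \<le> tv_norm (\<lambda>A. measure z A - measure w A)"
  using sum_partition_le_tv_norm[OF assms unit_I_in_partitions] by simp

lemma tv_norm_measure:
  assumes "nonneg_measure_I z"
  shows "tv_norm (measure z) = measure z unit_I"
proof (rule antisym)
  show "tv_norm (measure z) \<le> measure z unit_I"
    by (rule tv_norm_leI) (simp add: sum_measure_partition[OF assms])
  have "nonneg_measure_I (null_measure borel_I)"
    by (simp add: nonneg_measure_I_def finite_measureI)
  from sum_partition_le_tv_norm[OF assms this unit_I_in_partitions]
  show "measure z unit_I \<le> tv_norm (measure z)" by simp
qed

text \<open>
  This is how the loss of mass is charged when a transported part is thinned out: passing from \<open>z\<close> to a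
  smaller measure costs exactly the difference of the masses.
\<close>

lemma tv_norm_diff_submeasure:
  assumes "nonneg_measure_I y" "nonneg_measure_I z" "nonneg_measure_I w"
    and le: "\<And>A. A \<in> sets borel_I \<Longrightarrow> measure w A \<le> measure z A"
  shows "tv_norm (\<lambda>A. measure y A - measure w A)
     \<le> tv_norm (\<lambda>A. measure y A - measure z A) + (measure z unit_I - measure w unit_I)"
proof (rule tv_norm_leI)
  fix P assume P: "P \<in> partitions_I"
  have "(\<Sum>A\<in>P. \<bar>measure y A - measure w A\<bar>)
     \<le> (\<Sum>A\<in>P. \<bar>measure y A - measure z A\<bar> + (measure z A - measure w A))"
    using P by (intro sum_mono) (smt (verit) le mem_Collect_eq subsetD)
  also have "\<dots> = (\<Sum>A\<in>P. \<bar>measure y A - measure z A\<bar>) + (measure z unit_I - measure w unit_I)"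
    using sum_measure_partition[OF assms(2) P] sum_measure_partition[OF assms(3) P]
    by (simp add: sum.distrib sum_subtractf)
  finally show "(\<Sum>A\<in>P. \<bar>measure y A - measure w A\<bar>)
     \<le> tv_norm (\<lambda>A. measure y A - measure z A) + (measure z unit_I - measure w unit_I)"
    using sum_partition_le_tv_norm[OF assms(1,2) P] by simp
qed

lemma tv_norm_self_diff: "nonneg_measure_I z \<Longrightarrow> tv_norm (\<lambda>A. measure z A - measure z A) = 0"
  by (rule antisym, rule tv_norm_leI) (use tv_norm_diff_nonneg[of z z] in auto)

section \<open>Couplings and the generalised Wasserstein distance\<close>

abbreviation transport_cost :: "(real \<times> real) measure \<Rightarrow> real" where
  "transport_cost \<gamma> \<equiv> \<integral>p. \<bar>fst p - snd p\<bar> \<partial>\<gamma>"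

lemma coupling_marginals:
  assumes "\<gamma> \<in> couplings z1 z2"
  shows "fst \<in> measurable \<gamma> borel_I" "snd \<in> measurable \<gamma> borel_I"
    "sets \<gamma> = sets (borel_I \<Otimes>\<^sub>M borel_I)" "space \<gamma> = unit_I \<times> unit_I"
    "distr \<gamma> borel_I fst = z1" "distr \<gamma> borel_I snd = z2"
proof -
  show s: "sets \<gamma> = sets (borel_I \<Otimes>\<^sub>M borel_I)" 
    and "distr \<gamma> borel_I fst = z1" "distr \<gamma> borel_I snd = z2" using assms by (auto simp: couplings_def)
  show "fst \<in> measurable \<gamma> borel_I" "snd \<in> measurable \<gamma> borel_I"
    unfolding measurable_cong_sets[OF s refl] by simp_all
  show "space \<gamma> = unit_I \<times> unit_I"
    using sets_eq_imp_space_eq[OF s] by (simp add: space_pair_measure space_restrict_space)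
qed

lemma coupling_finite:
  assumes "\<gamma> \<in> couplings z1 z2" "nonneg_measure_I z1"
  shows "finite_measure \<gamma>"
proof (rule finite_measureI)
  have "emeasure z1 (space z1) = emeasure \<gamma> (space \<gamma>)"
    using coupling_marginals[OF assms(1)]
    by (metis emeasure_distr measurable_space sets.top space_distr vimage_eq subsetI Int_absorb1)
  then show "emeasure \<gamma> (space \<gamma>) \<noteq> \<infinity>"
    using finite_measure.emeasure_finite[OF finite_nonneg_measure_I[OF assms(2)], of "space z1"]
    by (simp add: top_unique)
qed

lemma coupling_mass:
  assumes "\<gamma> \<in> couplings z1 z2"
  shows "measure z1 unit_I = measure \<gamma> (space \<gamma>)" "measure z2 unit_I = measure \<gamma> (space \<gamma>)"
proof -
  note c = coupling_marginals[OF assms]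
  have "unit_I \<in> sets borel_I" by (auto simp: sets_restrict_space)
  then show "measure z1 unit_I = measure \<gamma> (space \<gamma>)" "measure z2 unit_I = measure \<gamma> (space \<gamma>)"
    unfolding c(5)[symmetric] c(6)[symmetric]
    by (auto simp: measure_distr c(1,2,4) intro!: arg_cong[where f="measure \<gamma>"])
qed

lemma d_W_le: "\<gamma> \<in> couplings z1 z2 \<Longrightarrow> d_W z1 z2 \<le> transport_cost \<gamma>"
  unfolding d_W_def by (intro cINF_lower bdd_belowI2[where m=0]) auto

text \<open>
  The normalised product measure is a coupling.  Without one, \<open>d_W\<close> would be an infimum over the empty
  set, about whose value nothing is known.
\<close>

lemma couplings_nonempty:
  assumes z: "nonneg_measure_I z1" "nonneg_measure_I z2"
    and eq: "measure z1 unit_I = measure z2 unit_I"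
  shows "couplings z1 z2 \<noteq> {}"
proof -
  interpret z1: finite_measure z1 by (rule finite_nonneg_measure_I[OF z(1)])
  interpret z2: finite_measure z2 by (rule finite_nonneg_measure_I[OF z(2)])
  interpret pair_sigma_finite z1 z2 ..
  note sets = sets_nonneg_measure_I[OF z(1)] sets_nonneg_measure_I[OF z(2)]
  note sp = space_nonneg_measure_I[OF z(1)] space_nonneg_measure_I[OF z(2)]
  define M where "M = measure z1 unit_I"
  define \<gamma> where "\<gamma> = scale_measure (ennreal (inverse M)) (z1 \<Otimes>\<^sub>M z2)"
  have s: "sets \<gamma> = sets (borel_I \<Otimes>\<^sub>M borel_I)"
    unfolding \<gamma>_def by (simp add: sets_pair_measure_cong[OF sets])
  have sg: "space \<gamma> = unit_I \<times> unit_I"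
    using sets_eq_imp_space_eq[OF s] by (simp add: space_pair_measure space_restrict_space)
  have M1: "emeasure z1 unit_I = ennreal M" "emeasure z2 unit_I = ennreal M"
    using eq by (simp_all add: M_def z1.emeasure_eq_measure z2.emeasure_eq_measure)
  have scale: "ennreal (inverse M) * (emeasure w A * ennreal M) = emeasure w A"
    if "w = z1 \<or> w = z2" "A \<in> sets borel_I" for w A
  proof (cases "M = 0")
    case True
    have "A \<subseteq> unit_I" using that(2) by (auto simp: sets_restrict_space)
    then have "emeasure w A \<le> emeasure w unit_I" using that(1) sets sp 
      by (intro emeasure_mono) (metis sets.top)+
    then show ?thesis using True M1 that(1) by auto
  next
    case False
    then have "0 < M" by (simp add: M_def less_le)
    then have "ennreal (inverse M) * ennreal M = 1"
      by (simp add: ennreal_mult'[symmetric])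
    then show ?thesis by (metis mult.assoc mult.commute mult.left_neutral)
  qed
  have "distr \<gamma> borel_I fst = z1"
  proof (rule measure_eqI)
    fix A assume "A \<in> sets (distr \<gamma> borel_I fst)"
    then have A: "A \<in> sets borel_I" by simp
    have "A \<subseteq> unit_I" using A by (auto simp: sets_restrict_space)
    then have "fst -` A \<inter> space \<gamma> = A \<times> unit_I" unfolding sg by auto
    then have "emeasure (distr \<gamma> borel_I fst) A = emeasure \<gamma> (A \<times> unit_I)"
      using A by (subst emeasure_distr) (simp_all add: measurable_cong_sets[OF s refl])
    also have "\<dots> = ennreal (inverse M) * (emeasure z1 A * emeasure z2 unit_I)"
      unfolding \<gamma>_def using A sets sp by (subst emeasure_scale_measure, subst z2.emeasure_pair_measure_Times) (auto, metis sets.top)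
    finally show "emeasure (distr \<gamma> borel_I fst) A = emeasure z1 A"
      using scale[of z1 A] A M1 by simp
  qed (use sets in simp)
  moreover have "distr \<gamma> borel_I snd = z2"
  proof (rule measure_eqI)
    fix A assume "A \<in> sets (distr \<gamma> borel_I snd)"
    then have A: "A \<in> sets borel_I" by simp
    have "A \<subseteq> unit_I" using A by (auto simp: sets_restrict_space)
    then have "snd -` A \<inter> space \<gamma> = unit_I \<times> A" unfolding sg by auto
    then have "emeasure (distr \<gamma> borel_I snd) A = emeasure \<gamma> (unit_I \<times> A)"
      using A by (subst emeasure_distr) (simp_all add: measurable_cong_sets[OF s refl])
    also have "\<dots> = ennreal (inverse M) * (emeasure z1 unit_I * emeasure z2 A)"
      unfolding \<gamma>_def using A sets sp by (subst emeasure_scale_measure, subst z2.emeasure_pair_measure_Times) (auto, metis sets.top)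
    finally show "emeasure (distr \<gamma> borel_I snd) A = emeasure z2 A"
      using scale[of z2 A] A M1 by (simp add: mult.commute)
  qed (use sets in simp)
  ultimately show ?thesis using s by (auto simp: couplings_def)
qed

lemma d_W_nonneg:
  assumes "nonneg_measure_I z1" "nonneg_measure_I z2" "measure z1 unit_I = measure z2 unit_I"
  shows "0 \<le> d_W z1 z2"
  unfolding d_W_def using couplings_nonempty[OF assms] by (intro cINF_greatest) auto

lemma d_GW_le:
  assumes x: "nonneg_measure_I x1" "nonneg_measure_I x2"
    and z: "nonneg_measure_I z1" "nonneg_measure_I z2" and \<gamma>: "\<gamma> \<in> couplings z1 z2"
  shows "d_GW x1 x2 \<le> tv_norm (\<lambda>A. measure x1 A - measure z1 A) + transport_cost \<gamma>
           + tv_norm (\<lambda>A. measure x2 A - measure z2 A)"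
proof -
  have "d_GW x1 x2 \<le> tv_norm (\<lambda>A. measure x1 A - measure z1 A) + d_W z1 z2
           + tv_norm (\<lambda>A. measure x2 A - measure z2 A)"
    unfolding d_GW_def
  proof (rule order_trans[OF cINF_lower[where x="(z1, z2)"]])
    show "bdd_below ((\<lambda>(z1, z2). tv_norm (\<lambda>A. measure x1 A - measure z1 A) + d_W z1 z2
           + tv_norm (\<lambda>A. measure x2 A - measure z2 A)) `
          {(z1, z2). nonneg_measure_I z1 \<and> nonneg_measure_I z2 \<and>
                     tv_norm (measure z1) = tv_norm (measure z2)})"
      using tv_norm_diff_nonneg x d_W_nonneg
      by (intro bdd_belowI2[where m=0]) (auto simp: tv_norm_measure)
  qed (use z coupling_mass[OF \<gamma>] in \<open>auto simp: tv_norm_measure\<close>)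
  then show ?thesis using d_W_le[OF \<gamma>] by simp
qed

lemma d_GW_near_optimal:
  assumes "e > 0"
  obtains z1 z2 \<gamma> where "nonneg_measure_I z1" "nonneg_measure_I z2" "\<gamma> \<in> couplings z1 z2"
    "tv_norm (\<lambda>A. measure x1 A - measure z1 A) + transport_cost \<gamma>
      + tv_norm (\<lambda>A. measure x2 A - measure z2 A) < d_GW x1 x2 + e"
proof -
  let ?S = "{(z1, z2). nonneg_measure_I z1 \<and> nonneg_measure_I z2 \<and>
                       tv_norm (measure z1) = tv_norm (measure z2)}"
  let ?f = "\<lambda>(z1, z2). tv_norm (\<lambda>A. measure x1 A - measure z1 A) + d_W z1 z2
           + tv_norm (\<lambda>A. measure x2 A - measure z2 A)"
  have "nonneg_measure_I (null_measure borel_I)"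
    by (simp add: nonneg_measure_I_def finite_measureI)
  then have "?f ` ?S \<noteq> {}" by auto
  then have "\<exists>v\<in>?f ` ?S. v < d_GW x1 x2 + e / 2"
    by (rule cInf_lessD) (use assms in \<open>simp add: d_GW_def\<close>)
  then obtain z1 z2 where z: "nonneg_measure_I z1" "nonneg_measure_I z2"
      "measure z1 unit_I = measure z2 unit_I"
    and less: "tv_norm (\<lambda>A. measure x1 A - measure z1 A) + d_W z1 z2
           + tv_norm (\<lambda>A. measure x2 A - measure z2 A) < d_GW x1 x2 + e / 2"
    by (auto simp: tv_norm_measure)
  have "transport_cost ` couplings z1 z2 \<noteq> {}" using couplings_nonempty[OF z] by simp
  then have "\<exists>v\<in>transport_cost ` couplings z1 z2. v < d_W z1 z2 + e / 2"
    by (rule cInf_lessD) (use assms in \<open>simp add: d_W_def\<close>)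
  then obtain \<gamma> where "\<gamma> \<in> couplings z1 z2" "transport_cost \<gamma> < d_W z1 z2 + e / 2"
    by auto
  with z less show ?thesis by (intro that[of z1 z2 \<gamma>]) auto
qed

section \<open>Transport through an atomic measure\<close>

text \<open>
  A plan that carries \<open>z1\<close> to \<open>z2\<close> is continued by carrying a unit at \<open>u\<close> on to \<open>v\<close> with intensity
  \<open>g (u, v)\<close> with respect to \<open>y\<close>.  The new plan is the image under \<open>((s, u), v) \<mapsto> (s, v)\<close> of the product
  of \<open>\<gamma>\<close> and \<open>y\<close> with density \<open>g (u, v)\<close>, which avoids disintegrating \<open>\<gamma>\<close>.  The bounds on the partial
  integrals of \<open>g\<close> make its marginals smaller than \<open>z1\<close> and \<open>y\<close>, and each unit is moved at
  most \<open>\<epsilon>\<close> further.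
\<close>

lemma reroute_coupling:
  fixes g :: "real \<times> real \<Rightarrow> ennreal"
  assumes z: "nonneg_measure_I z1" "nonneg_measure_I z2" and y: "nonneg_measure_I y"
    and \<gamma>: "\<gamma> \<in> couplings z1 z2"
    and g: "g \<in> borel_measurable (borel_I \<Otimes>\<^sub>M borel_I)"
    and out: "\<And>u. u \<in> unit_I \<Longrightarrow> (\<integral>\<^sup>+v. g (u, v) \<partial>y) \<le> 1"
    and into: "\<And>v. v \<in> unit_I \<Longrightarrow> (\<integral>\<^sup>+u. g (u, v) \<partial>z2) \<le> 1"
    and near: "\<And>u v. g (u, v) \<noteq> 0 \<Longrightarrow> \<bar>u - v\<bar> \<le> \<epsilon>"
    and \<epsilon>: "0 \<le> \<epsilon>"
  obtains w1 w2 \<gamma>' where "nonneg_measure_I w1" "nonneg_measure_I w2" "\<gamma>' \<in> couplings w1 w2"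
    "\<forall>A\<in>sets borel_I. measure w1 A \<le> measure z1 A"
    "\<forall>A\<in>sets borel_I. measure w2 A \<le> measure y A"
    "emeasure w2 unit_I = (\<integral>\<^sup>+v. (\<integral>\<^sup>+u. g (u, v) \<partial>z2) \<partial>y)"
    "transport_cost \<gamma>' \<le> transport_cost \<gamma> + \<epsilon> * measure w2 unit_I"
proof -
  note c = coupling_marginals[OF \<gamma>]
  interpret \<gamma>: finite_measure \<gamma> by (rule coupling_finite[OF \<gamma> z(1)])
  interpret y: finite_measure y by (rule finite_nonneg_measure_I[OF y])
  interpret z1: finite_measure z1 by (rule finite_nonneg_measure_I[OF z(1)])
  interpret pair_sigma_finite \<gamma> y ..
  note setsy = sets_nonneg_measure_I[OF y] and spy = space_nonneg_measure_I[OF y]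
  let ?B = "borel_I \<Otimes>\<^sub>M borel_I"
  let ?P = "\<gamma> \<Otimes>\<^sub>M y"
  define h :: "(real \<times> real) \<times> real \<Rightarrow> real \<times> real" where "h p = (fst (fst p), snd p)" for p
  define G where "G p = g (snd (fst p), snd p)" for p :: "(real \<times> real) \<times> real"
  have sP: "sets ?P = sets (?B \<Otimes>\<^sub>M borel_I)"
    by (rule sets_pair_measure_cong[OF c(3) setsy])
  have hm: "h \<in> measurable ?P ?B"
    unfolding h_def measurable_cong_sets[OF sP refl] by measurable
  have Gm: "G \<in> borel_measurable ?P"
    unfolding G_def measurable_cong_sets[OF sP refl]
    by (rule measurable_compose[OF _ g]) measurable
  define \<gamma>' where "\<gamma>' = distr (density ?P G) ?B h"
  have s': "sets \<gamma>' = sets ?B" by (simp add: \<gamma>'_def)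
  have sp': "space \<gamma>' = unit_I \<times> unit_I"
    using sets_eq_imp_space_eq[OF s'] by (simp add: space_pair_measure space_restrict_space)
  have int': "(\<integral>\<^sup>+p. k p \<partial>\<gamma>') = (\<integral>\<^sup>+p. G p * k (h p) \<partial>?P)"
    if "k \<in> borel_measurable ?B" for k
    unfolding \<gamma>'_def using that hm Gm
    by (subst nn_integral_distr, simp, simp, subst nn_integral_density)
       (auto intro: measurable_compose[OF hm])
  have Gk: "(\<lambda>p. G p * k (h p)) \<in> borel_measurable ?P" if "k \<in> borel_measurable ?B" for k
    using Gm measurable_compose[OF hm that] by measurable
  have int_fst: "(\<integral>\<^sup>+p. G p * k (h p) \<partial>?P) = (\<integral>\<^sup>+w. \<integral>\<^sup>+v. g (snd w, v) * k (fst w, v) \<partial>y \<partial>\<gamma>)"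
    if "k \<in> borel_measurable ?B" for k
    using y.nn_integral_fst[OF Gk[OF that]] by (simp add: G_def h_def)
  have int_snd: "(\<integral>\<^sup>+p. G p * k (h p) \<partial>?P) = (\<integral>\<^sup>+v. \<integral>\<^sup>+w. g (snd w, v) * k (fst w, v) \<partial>\<gamma> \<partial>y)"
    if "k \<in> borel_measurable ?B" for k
    using nn_integral_snd[OF Gk[OF that]] by (simp add: G_def h_def)
  have g1: "(\<lambda>v. g (u, v)) \<in> borel_measurable borel_I" if "u \<in> unit_I" for u
    using that by (intro measurable_compose[OF _ g]) (simp add: space_restrict_space)
  have g2: "(\<lambda>u. g (u, v)) \<in> borel_measurable borel_I" if "v \<in> unit_I" for v
    using that by (intro measurable_compose[OF _ g]) (simp add: space_restrict_space)
  have gy: "(\<lambda>v. g (u, v)) \<in> borel_measurable y" if "u \<in> unit_I" for u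
    using g1[OF that] by (simp add: measurable_cong_sets[OF setsy refl])
  have out': "(\<integral>\<^sup>+v. g (snd w, v) \<partial>y) \<le> 1" if "w \<in> space \<gamma>" for w
    using that out c(4) by auto
  have into_\<gamma>: "(\<integral>\<^sup>+w. g (snd w, v) \<partial>\<gamma>) = (\<integral>\<^sup>+u. g (u, v) \<partial>z2)" if "v \<in> unit_I" for v
    unfolding c(6)[symmetric] using g2[OF that] c(2) by (subst nn_integral_distr) auto

  define w1 where "w1 = distr \<gamma>' borel_I fst"
  define w2 where "w2 = distr \<gamma>' borel_I snd"
  have fstm: "fst \<in> measurable \<gamma>' borel_I" and sndm: "snd \<in> measurable \<gamma>' borel_I"
    by (simp_all add: measurable_cong_sets[OF s' refl])
  have w1_le: "emeasure w1 A \<le> emeasure z1 A" if A: "A \<in> sets borel_I" for A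
  proof -
    have k: "(\<lambda>p. indicator A (fst p) :: ennreal) \<in> borel_measurable ?B"
      using A by measurable
    have "emeasure w1 A = (\<integral>\<^sup>+p. indicator A (fst p) \<partial>\<gamma>')"
      unfolding w1_def using A fstm nn_integral_distr[OF fstm, of "indicator A"] by simp
    also have "\<dots> = (\<integral>\<^sup>+w. \<integral>\<^sup>+v. g (snd w, v) * indicator A (fst w) \<partial>y \<partial>\<gamma>)"
      using int'[OF k] int_fst[OF k] by simp
    also have "\<dots> \<le> (\<integral>\<^sup>+w. indicator A (fst w) \<partial>\<gamma>)"
    proof (rule nn_integral_mono)
      fix w assume w: "w \<in> space \<gamma>"
      then have "(\<integral>\<^sup>+v. g (snd w, v) * indicator A (fst w) \<partial>y)
          = (\<integral>\<^sup>+v. g (snd w, v) \<partial>y) * indicator A (fst w)"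
        using c(4) by (intro nn_integral_multc gy) auto
      also have "\<dots> \<le> 1 * indicator A (fst w)"
        by (intro mult_right_mono out'[OF w]) simp
      finally show "(\<integral>\<^sup>+v. g (snd w, v) * indicator A (fst w) \<partial>y) \<le> indicator A (fst w)" by simp
    qed
    also have "\<dots> = emeasure z1 A"
      using A nn_integral_distr[OF c(1), of "indicator A"] c(5) sets_nonneg_measure_I[OF z(1)] by simp
    finally show ?thesis .
  qed
  have w2_eq: "emeasure w2 A = (\<integral>\<^sup>+v. (\<integral>\<^sup>+u. g (u, v) \<partial>z2) * indicator A v \<partial>y)" 
    if A: "A \<in> sets borel_I" for A
  proof -
    have k: "(\<lambda>p. indicator A (snd p) :: ennreal) \<in> borel_measurable ?B"
      using A by measurable
    have "emeasure w2 A = (\<integral>\<^sup>+p. indicator A (snd p) \<partial>\<gamma>')"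
      unfolding w2_def using A sndm nn_integral_distr[OF sndm, of "indicator A"] by simp
    also have "\<dots> = (\<integral>\<^sup>+v. \<integral>\<^sup>+w. g (snd w, v) * indicator A v \<partial>\<gamma> \<partial>y)"
      using int'[OF k] int_snd[OF k] by simp
    also have "\<dots> = (\<integral>\<^sup>+v. (\<integral>\<^sup>+u. g (u, v) \<partial>z2) * indicator A v \<partial>y)"
    proof (rule nn_integral_cong)
      fix v assume "v \<in> space y"
      then have v: "v \<in> unit_I" using spy by simp
      then show "(\<integral>\<^sup>+w. g (snd w, v) * indicator A v \<partial>\<gamma>) = (\<integral>\<^sup>+u. g (u, v) \<partial>z2) * indicator A v"
        using into_\<gamma>[OF v] measurable_compose[OF c(2) g2[OF v]]
        by (subst nn_integral_multc) auto
    qed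
    finally show ?thesis .
  qed
  have w2_le: "emeasure w2 A \<le> emeasure y A" if A: "A \<in> sets borel_I" for A
  proof -
    have "emeasure w2 A \<le> (\<integral>\<^sup>+v. 1 * indicator A v \<partial>y)"
      unfolding w2_eq[OF A] using into spy by (intro nn_integral_mono mult_right_mono) auto
    then show ?thesis using A setsy by simp
  qed
  have I: "unit_I \<in> sets borel_I" by (auto simp: sets_restrict_space)
  have mass: "emeasure w2 unit_I = (\<integral>\<^sup>+v. (\<integral>\<^sup>+u. g (u, v) \<partial>z2) \<partial>y)"
    unfolding w2_eq[OF I] using spy by (intro nn_integral_cong) auto
  have nonneg: "nonneg_measure_I w" if "w = w1 \<or> w = w2" for w
  proof -
    have "sets w = sets borel_I" using that by (auto simp: w1_def w2_def)
    moreover have "space w = unit_I" using sets_eq_imp_space_eq[OF calculation]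
      by (simp add: space_restrict_space)
    moreover have "emeasure w unit_I \<le> emeasure z1 unit_I \<or> emeasure w unit_I \<le> emeasure y unit_I"
      using that w1_le[OF I] w2_le[OF I] by auto
    then have "emeasure w unit_I \<noteq> \<infinity>"
      using z1.emeasure_finite y.emeasure_finite by (metis infinity_ennreal_def neq_top_trans)
    ultimately show ?thesis by (auto simp: nonneg_measure_I_def intro!: finite_measureI)
  qed
  have coup: "\<gamma>' \<in> couplings w1 w2"
    unfolding couplings_def w1_def w2_def using s' by simp
  interpret w2: finite_measure w2 by (rule finite_nonneg_measure_I[OF nonneg]) simp

  have meas_cost: "(\<lambda>p. \<bar>fst p - snd p\<bar>) \<in> borel_measurable ?B"
  proof -
    have id: "(\<lambda>s. s) \<in> borel_measurable borel_I" by (rule measurable_restrict_space1) simp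
    show ?thesis
      using measurable_compose[OF measurable_fst id] measurable_compose[OF measurable_snd id]
      by (intro borel_measurable_abs borel_measurable_diff)
  qed
  have cost: "(\<integral>\<^sup>+p. ennreal \<bar>fst p - snd p\<bar> \<partial>\<gamma>')
      \<le> (\<integral>\<^sup>+p. ennreal \<bar>fst p - snd p\<bar> \<partial>\<gamma>) + ennreal \<epsilon> * emeasure w2 unit_I"
  proof -
    have m: "(\<lambda>p. ennreal \<bar>fst p - snd p\<bar>) \<in> borel_measurable ?B"
      using meas_cost by measurable
    have "(\<integral>\<^sup>+p. ennreal \<bar>fst p - snd p\<bar> \<partial>\<gamma>')
        = (\<integral>\<^sup>+w. \<integral>\<^sup>+v. g (snd w, v) * ennreal \<bar>fst w - v\<bar> \<partial>y \<partial>\<gamma>)"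
      using int'[OF m] int_fst[OF m] by simp
    also have "\<dots> \<le> (\<integral>\<^sup>+w. ennreal \<bar>fst w - snd w\<bar> + ennreal \<epsilon> * (\<integral>\<^sup>+v. g (snd w, v) \<partial>y) \<partial>\<gamma>)"
    proof (rule nn_integral_mono)
      fix w assume w: "w \<in> space \<gamma>"
      have gw: "(\<lambda>v. g (snd w, v)) \<in> borel_measurable y" using w c(4) by (intro gy) auto
      have "(\<integral>\<^sup>+v. g (snd w, v) * ennreal \<bar>fst w - v\<bar> \<partial>y)
         \<le> (\<integral>\<^sup>+v. ennreal (\<bar>fst w - snd w\<bar> + \<epsilon>) * g (snd w, v) \<partial>y)"
      proof (rule nn_integral_mono)
        fix v
        show "g (snd w, v) * ennreal \<bar>fst w - v\<bar> \<le> ennreal (\<bar>fst w - snd w\<bar> + \<epsilon>) * g (snd w, v)"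
        proof (cases "g (snd w, v) = 0")
          case False
          from near[OF this] have "\<bar>fst w - v\<bar> \<le> \<bar>fst w - snd w\<bar> + \<epsilon>" by linarith
          then show ?thesis by (subst mult.commute) (intro mult_right_mono ennreal_leI, auto)
        qed simp
      qed
      also have "\<dots> = ennreal \<bar>fst w - snd w\<bar> * (\<integral>\<^sup>+v. g (snd w, v) \<partial>y) + ennreal \<epsilon> * (\<integral>\<^sup>+v. g (snd w, v) \<partial>y)"
        using \<epsilon> by (subst nn_integral_cmult[OF gw]) (simp add: ennreal_plus distrib_right)
      also have "\<dots> \<le> ennreal \<bar>fst w - snd w\<bar> * 1 + ennreal \<epsilon> * (\<integral>\<^sup>+v. g (snd w, v) \<partial>y)"
        by (intro add_right_mono mult_left_mono out'[OF w]) simp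
      finally show "(\<integral>\<^sup>+v. g (snd w, v) * ennreal \<bar>fst w - v\<bar> \<partial>y)
         \<le> ennreal \<bar>fst w - snd w\<bar> + ennreal \<epsilon> * (\<integral>\<^sup>+v. g (snd w, v) \<partial>y)" by simp
    qed
    also have "\<dots> = (\<integral>\<^sup>+w. ennreal \<bar>fst w - snd w\<bar> \<partial>\<gamma>)
        + ennreal \<epsilon> * (\<integral>\<^sup>+w. \<integral>\<^sup>+v. g (snd w, v) \<partial>y \<partial>\<gamma>)"
    proof -
      have gg: "(\<lambda>w. \<integral>\<^sup>+v. g (snd w, v) \<partial>y) \<in> borel_measurable \<gamma>"
        using y.borel_measurable_nn_integral_fst[OF Gm] by (simp add: G_def)
      have mm: "(\<lambda>p. ennreal \<bar>fst p - snd p\<bar>) \<in> borel_measurable \<gamma>"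
        using m by (simp add: measurable_cong_sets[OF c(3) refl])
      show ?thesis
        using gg mm by (simp add: nn_integral_add nn_integral_cmult)
    qed
    also have "(\<integral>\<^sup>+w. \<integral>\<^sup>+v. g (snd w, v) \<partial>y \<partial>\<gamma>) = emeasure w2 unit_I"
    proof -
      have "(\<integral>\<^sup>+w. \<integral>\<^sup>+v. g (snd w, v) \<partial>y \<partial>\<gamma>) = (\<integral>\<^sup>+v. \<integral>\<^sup>+w. g (snd w, v) \<partial>\<gamma> \<partial>y)"
        using int_fst[of "\<lambda>_. 1"] int_snd[of "\<lambda>_. 1"] by simp
      also have "\<dots> = (\<integral>\<^sup>+v. (\<integral>\<^sup>+u. g (u, v) \<partial>z2) \<partial>y)"
        using into_\<gamma> spy by (intro nn_integral_cong) auto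
      finally show ?thesis using mass by simp
    qed
    finally show ?thesis .
  qed
  have fin: "integrable \<gamma> (\<lambda>p. \<bar>fst p - snd p\<bar>)"
    by (rule \<gamma>.integrable_const_bound[where B=1])
       (use c(4) meas_cost in \<open>auto simp: measurable_cong_sets[OF c(3) refl] intro!: AE_I2\<close>)
  have "ennreal (transport_cost \<gamma>') \<le> ennreal (transport_cost \<gamma> + \<epsilon> * measure w2 unit_I)"
  proof -
    have "finite_measure \<gamma>'" by (rule coupling_finite[OF coup nonneg]) simp
    then interpret \<gamma>': finite_measure \<gamma>' .
    have fin': "integrable \<gamma>' (\<lambda>p. \<bar>fst p - snd p\<bar>)"
      by (rule \<gamma>'.integrable_const_bound[where B=1])
         (use sp' meas_cost in \<open>auto simp: measurable_cong_sets[OF s' refl] intro!: AE_I2\<close>)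
    show ?thesis
      using cost \<epsilon> by (simp add: nn_integral_eq_integral[OF fin] nn_integral_eq_integral[OF fin']
          w2.emeasure_eq_measure ennreal_mult ennreal_plus)
  qed
  then have tc: "transport_cost \<gamma>' \<le> transport_cost \<gamma> + \<epsilon> * measure w2 unit_I"
    using \<epsilon> by (subst (asm) ennreal_le_iff) (simp_all add: add_nonneg_nonneg)
  show ?thesis
  proof (rule that[OF nonneg nonneg coup])
    show "\<forall>A\<in>sets borel_I. measure w1 A \<le> measure z1 A"
      using w1_le z1.emeasure_finite unfolding measure_def
      by (intro ballI enn2real_mono) (auto simp: less_top[symmetric])
    show "\<forall>A\<in>sets borel_I. measure w2 A \<le> measure y A"
      using w2_le y.emeasure_finite unfolding measure_def
      by (intro ballI enn2real_mono) (auto simp: less_top[symmetric])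
  qed (use mass tc in auto)
qed

lemma sum_le_1_of_disjoint:
  fixes F :: "'i \<Rightarrow> ennreal"
  assumes "finite S" "\<And>i. i \<in> S \<Longrightarrow> F i \<le> 1"
    "\<And>i j. i \<in> S \<Longrightarrow> j \<in> S \<Longrightarrow> F i \<noteq> 0 \<Longrightarrow> F j \<noteq> 0 \<Longrightarrow> i = j"
  shows "sum F S \<le> 1"
proof (cases "\<exists>i\<in>S. F i \<noteq> 0")
  case True
  then obtain i where i: "i \<in> S" "F i \<noteq> 0" by blast
  have "sum F S = sum F {i}"
    using assms(1,3) i by (intro sum.mono_neutral_right) auto
  then show ?thesis using assms(2) i by simp
qed simp

text \<open>
  Let a near-optimal plan between \<open>x\<close> and \<open>chi\<close> deliver the mass \<open>a i\<close> to the atom \<open>t i\<close>.  Of it,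
  \<open>min (a i) (min (c i) (r i))\<close> is spread over \<open>R i\<close> in proportion to \<open>y\<close>, where \<open>c i\<close> and \<open>r i\<close> are the
  masses of \<open>chi\<close> at \<open>t i\<close> and of \<open>y\<close> on \<open>R i\<close>; the rest is discarded at both ends.  The discarded mass is
  at most \<open>\<bar>c i - a i\<bar> + \<bar>c i - r i\<bar>\<close>, whose first part is already paid for in the distance from \<open>x\<close>
  to \<open>chi\<close>.  Capping by \<open>c i\<close> keeps the extra transport cost below \<open>\<epsilon>\<close> times the mass of \<open>chi\<close>.
\<close>

lemma d_GW_through_atoms:
  fixes t :: "nat \<Rightarrow> real" and R :: "nat \<Rightarrow> real set"
  assumes x: "nonneg_measure_I x" and chi: "nonneg_measure_I chi" and y: "nonneg_measure_I y"
    and t: "inj_on t {1..k}" "t ` {1..k} \<subseteq> unit_I"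
    and R: "\<And>i. i \<in> {1..k} \<Longrightarrow> R i \<in> sets borel_I" "disjoint_family_on R {1..k}"
    and near: "\<And>i v. i \<in> {1..k} \<Longrightarrow> v \<in> R i \<Longrightarrow> \<bar>t i - v\<bar> \<le> \<epsilon>" and \<epsilon>: "0 \<le> \<epsilon>"
    and supp: "supported_on chi (t ` {1..k})"
  shows "d_GW x y \<le> d_GW x chi + \<epsilon> * measure chi unit_I
      + (\<Sum>i\<in>{1..k}. \<bar>measure chi {t i} - measure y (R i)\<bar>) + measure y (unit_I - (\<Union>i\<in>{1..k}. R i))"
    (is "_ \<le> ?rhs")
proof (rule field_le_epsilon)
  fix e :: real assume "e > 0"
  from d_GW_near_optimal[OF this, of x chi] obtain z1 z2 \<gamma> where z: "nonneg_measure_I z1" "nonneg_measure_I z2"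
    and \<gamma>: "\<gamma> \<in> couplings z1 z2" and opt:
    "tv_norm (\<lambda>A. measure x A - measure z1 A) + transport_cost \<gamma>
      + tv_norm (\<lambda>A. measure chi A - measure z2 A) < d_GW x chi + e" by blast
  interpret y: finite_measure y by (rule finite_nonneg_measure_I[OF y])
  interpret z2: finite_measure z2 by (rule finite_nonneg_measure_I[OF z(2)])
  interpret chi: finite_measure chi by (rule finite_nonneg_measure_I[OF chi])
  let ?K = "{1..k}"
  let ?T = "t ` ?K"
  note sy = sets_nonneg_measure_I[OF y] and sz = sets_nonneg_measure_I[OF z(2)]
    and sc = sets_nonneg_measure_I[OF chi]
  have single: "{s} \<in> sets borel_I" if "s \<in> unit_I" for s
    using that by (auto simp: sets_restrict_space intro!: image_eqI[where x="{s}"])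
  have tI: "t i \<in> unit_I" if "i \<in> ?K" for i
    using t(2) imageI[OF that, of t] by (rule subsetD)
  have I: "unit_I \<in> sets borel_I" by (auto simp: sets_restrict_space)
  have T: "?T \<in> sets borel_I"
  proof -
    have "(\<Union>i\<in>?K. {t i}) \<in> sets borel_I" using tI single by (intro sets.finite_UN) auto
    moreover have "(\<Union>i\<in>?K. {t i}) = ?T" by auto
    ultimately show ?thesis by simp
  qed
  define a where "a i = measure z2 {t i}" for i
  define c where "c i = measure chi {t i}" for i
  define r where "r i = measure y (R i)" for i
  define w where "w i = min (a i) (min (c i) (r i))" for i
  \<comment> \<open>If \<open>a i\<close> or \<open>r i\<close> is zero then so is \<open>w i\<close>, and \<open>x / 0 = 0\<close> gives the right intensity.\<close>
  define \<kappa> where "\<kappa> i = w i / (a i * r i)" for i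
  have nn: "0 \<le> a i" "0 \<le> c i" "0 \<le> r i" "0 \<le> w i" "0 \<le> \<kappa> i" for i
    by (simp_all add: a_def c_def r_def w_def \<kappa>_def)
  have \<kappa>w: "\<kappa> i * a i * r i = w i" for i
    using nn[of i] by (auto simp: \<kappa>_def w_def min_def)
  have \<kappa>1: "\<kappa> i * r i \<le> 1" "\<kappa> i * a i \<le> 1" for i
  proof -
    have "w i \<le> a i" "w i \<le> r i" by (auto simp: w_def)
    then show "\<kappa> i * r i \<le> 1" "\<kappa> i * a i \<le> 1"
      using nn[of i] by (auto simp: \<kappa>_def divide_le_eq_1)
  qed
  define g :: "real \<times> real \<Rightarrow> ennreal" where
    "g p = (\<Sum>i\<in>?K. ennreal (\<kappa> i) * (indicator {t i} (fst p) * indicator (R i) (snd p)))" for p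
  have g_meas: "g \<in> borel_measurable (borel_I \<Otimes>\<^sub>M borel_I)"
    unfolding g_def using R(1) single[OF tI] by measurable
  have ind: "(\<lambda>u. indicator {t i} u :: ennreal) \<in> borel_measurable z2"
    "(\<lambda>v. indicator (R i) v :: ennreal) \<in> borel_measurable y" if "i \<in> ?K" for i
    using R(1)[OF that] single[OF tI[OF that]] sy sz by (auto intro!: borel_measurable_indicator)
  have out: "(\<integral>\<^sup>+v. g (u, v) \<partial>y) = (\<Sum>i\<in>?K. indicator {t i} u * ennreal (\<kappa> i * r i))" for u
  proof -
    have "(\<integral>\<^sup>+v. g (u, v) \<partial>y) = (\<Sum>i\<in>?K. \<integral>\<^sup>+v. (ennreal (\<kappa> i) * indicator {t i} u) * indicator (R i) v \<partial>y)"
      unfolding g_def using ind by (subst nn_integral_sum[symmetric]) (auto simp: mult.assoc)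
    also have "\<dots> = (\<Sum>i\<in>?K. indicator {t i} u * ennreal (\<kappa> i * r i))"
      using R(1) sy nn by (intro sum.cong refl, subst nn_integral_cmult_indicator)
        (auto simp: y.emeasure_eq_measure ennreal_mult r_def mult_ac)
    finally show ?thesis .
  qed
  have into: "(\<integral>\<^sup>+u. g (u, v) \<partial>z2) = (\<Sum>i\<in>?K. indicator (R i) v * ennreal (\<kappa> i * a i))" for v
  proof -
    have "(\<integral>\<^sup>+u. g (u, v) \<partial>z2) = (\<Sum>i\<in>?K. \<integral>\<^sup>+u. (ennreal (\<kappa> i) * indicator (R i) v) * indicator {t i} u \<partial>z2)"
      unfolding g_def using ind by (subst nn_integral_sum[symmetric]) (auto simp: mult_ac)
    also have "\<dots> = (\<Sum>i\<in>?K. indicator (R i) v * ennreal (\<kappa> i * a i))"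
      using single[OF tI] sz nn by (intro sum.cong refl, subst nn_integral_cmult_indicator)
        (auto simp: z2.emeasure_eq_measure ennreal_mult a_def mult_ac)
    finally show ?thesis .
  qed
  have out1: "(\<integral>\<^sup>+v. g (u, v) \<partial>y) \<le> 1" for u
    unfolding out
  proof (rule sum_le_1_of_disjoint)
    show "indicator {t i} u * ennreal (\<kappa> i * r i) \<le> 1" for i
      using \<kappa>1(1)[of i] by (cases "u = t i") simp_all
    show "i = j" if "i \<in> ?K" "j \<in> ?K" "indicator {t i} u * ennreal (\<kappa> i * r i) \<noteq> 0"
      "indicator {t j} u * ennreal (\<kappa> j * r j) \<noteq> 0" for i j
    proof -
      have "u = t i" "u = t j" using that(3,4) by (metis indicator_simps(2) mult_zero_left singletonD)+
      then have "t i = t j" by (rule subst)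
      then show ?thesis using inj_onD[OF t(1) _ that(1,2)] by blast
    qed
  qed simp
  have into1: "(\<integral>\<^sup>+u. g (u, v) \<partial>z2) \<le> 1" for v
    unfolding into
  proof (rule sum_le_1_of_disjoint)
    show "indicator (R i) v * ennreal (\<kappa> i * a i) \<le> 1" for i
      using \<kappa>1(2)[of i] by (cases "v \<in> R i") simp_all
    show "i = j" if "i \<in> ?K" "j \<in> ?K" "indicator (R i) v * ennreal (\<kappa> i * a i) \<noteq> 0"
      "indicator (R j) v * ennreal (\<kappa> j * a j) \<noteq> 0" for i j
    proof -
      have "v \<in> R i" "v \<in> R j" using that(3,4) by (metis indicator_simps(2) mult_zero_left)+
      then show ?thesis using R(2) that(1,2) unfolding disjoint_family_on_def by blast
    qed
  qed simp
  have near': "\<bar>u - v\<bar> \<le> \<epsilon>" if "g (u, v) \<noteq> 0" for u v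
  proof -
    have "\<exists>i\<in>?K. ennreal (\<kappa> i) * (indicator {t i} u * indicator (R i) v) \<noteq> 0"
      using that unfolding g_def fst_conv snd_conv by (rule contrapos_np) (intro sum.neutral, blast)
    then obtain i where "i \<in> ?K" "u = t i" "v \<in> R i"
      by (metis indicator_simps(2) mult_zero_left mult_zero_right singletonD)
    then show ?thesis using near by simp
  qed
  obtain w1 w2 \<gamma>' where w12: "nonneg_measure_I w1" "nonneg_measure_I w2" "\<gamma>' \<in> couplings w1 w2"
    and le1: "\<forall>A\<in>sets borel_I. measure w1 A \<le> measure z1 A"
    and le2: "\<forall>A\<in>sets borel_I. measure w2 A \<le> measure y A"
    and mass: "emeasure w2 unit_I = (\<integral>\<^sup>+v. (\<integral>\<^sup>+u. g (u, v) \<partial>z2) \<partial>y)"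
    and cost: "transport_cost \<gamma>' \<le> transport_cost \<gamma> + \<epsilon> * measure w2 unit_I"
    by (rule reroute_coupling[OF z y \<gamma> g_meas out1 into1 _ \<epsilon>]) (erule near', (rule that; assumption))
  have W: "measure w2 unit_I = sum w ?K"
  proof -
    have "emeasure w2 unit_I = (\<Sum>i\<in>?K. \<integral>\<^sup>+v. ennreal (\<kappa> i * a i) * indicator (R i) v \<partial>y)"
      unfolding mass into using ind by (subst nn_integral_sum[symmetric]) (auto simp: mult.commute)
    also have "\<dots> = (\<Sum>i\<in>?K. ennreal (w i))"
    proof (intro sum.cong refl)
      fix i assume i: "i \<in> ?K"
      have "(\<integral>\<^sup>+v. ennreal (\<kappa> i * a i) * indicator (R i) v \<partial>y) = ennreal (\<kappa> i * a i) * ennreal (r i)"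
        using R(1)[OF i] sy by (subst nn_integral_cmult_indicator) (auto simp: y.emeasure_eq_measure r_def)
      also have "\<dots> = ennreal (\<kappa> i * a i * r i)" using nn by (simp add: ennreal_mult)
      finally show "(\<integral>\<^sup>+v. ennreal (\<kappa> i * a i) * indicator (R i) v \<partial>y) = ennreal (w i)"
        by (simp only: \<kappa>w)
    qed
    also have "\<dots> = ennreal (sum w ?K)" using nn by (intro sum_ennreal) auto
    finally show ?thesis using nn by (simp add: measure_def sum_nonneg)
  qed
  have W1: "measure w1 unit_I = sum w ?K" using coupling_mass[OF w12(3)] W by simp
  have disj_t: "disjoint_family_on (\<lambda>i. {t i}) ?K"
    using inj_onD[OF t(1)] unfolding disjoint_family_on_def by blast
  have split_z2: "measure z1 unit_I = sum a ?K + measure z2 (unit_I - ?T)"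
  proof -
    have "measure z1 unit_I = measure z2 unit_I" using coupling_mass[OF \<gamma>] by simp
    also have "\<dots> = measure z2 ?T + measure z2 (unit_I - ?T)"
      using z2.finite_measure_Diff[of unit_I ?T, unfolded sz, OF I T t(2)] by linarith
    also have "measure z2 ?T = sum a ?K"
    proof -
      have "measure z2 (\<Union>i\<in>?K. {t i}) = (\<Sum>i\<in>?K. measure z2 {t i})"
        using single[OF tI] sz disj_t by (intro z2.finite_measure_finite_Union) auto
      moreover have "(\<Union>i\<in>?K. {t i}) = ?T" by auto
      ultimately show ?thesis by (simp add: a_def)
    qed
    finally show ?thesis .
  qed
  have split_y: "measure y unit_I = sum r ?K + measure y (unit_I - (\<Union>i\<in>?K. R i))"
  proof -
    have U: "(\<Union>i\<in>?K. R i) \<in> sets y" using R(1) sy by (intro sets.finite_UN) auto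
    then have "(\<Union>i\<in>?K. R i) \<subseteq> unit_I" using sets.sets_into_space space_nonneg_measure_I[OF y] by blast
    then have "measure y unit_I = measure y (\<Union>i\<in>?K. R i) + measure y (unit_I - (\<Union>i\<in>?K. R i))"
      using y.finite_measure_Diff[OF _ U, of unit_I] I[folded sy] by linarith
    also have "measure y (\<Union>i\<in>?K. R i) = sum r ?K"
      unfolding r_def using R sy by (intro y.finite_measure_finite_Union) auto
    finally show ?thesis .
  qed
  have chi_mass: "sum c ?K \<le> measure chi unit_I"
  proof -
    have "sum c ?K = measure chi (\<Union>i\<in>?K. {t i})"
      unfolding c_def using single[OF tI] sc disj_t
      by (intro chi.finite_measure_finite_Union[symmetric]) auto
    also have "\<dots> \<le> measure chi unit_I"
      using I sc t(2) by (intro chi.finite_measure_mono) auto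
    finally show ?thesis .
  qed
  have tv_chi: "(\<Sum>i\<in>?K. \<bar>c i - a i\<bar>) + measure z2 (unit_I - ?T) \<le> tv_norm (\<lambda>A. measure chi A - measure z2 A)"
  proof -
    \<comment> \<open>Off \<open>T\<close> the measure \<open>chi\<close> vanishes, so this partition detects all discrepancies that matter.\<close>
    define P where "P = insert (unit_I - ?T) ((\<lambda>i. {t i}) ` ?K)"
    have "P \<in> partitions_I"
      unfolding P_def using single[OF tI] I T t(2) by (auto simp: disjoint_def)
    from sum_partition_le_tv_norm[OF chi z(2) this]
    have "(\<Sum>A\<in>P. \<bar>measure chi A - measure z2 A\<bar>) \<le> tv_norm (\<lambda>A. measure chi A - measure z2 A)" .
    moreover have "(\<Sum>A\<in>P. \<bar>measure chi A - measure z2 A\<bar>)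
       = \<bar>measure chi (unit_I - ?T) - measure z2 (unit_I - ?T)\<bar> + (\<Sum>i\<in>?K. \<bar>c i - a i\<bar>)"
    proof -
      have "unit_I - ?T \<notin> (\<lambda>i. {t i}) ` ?K" by auto
      moreover have "inj_on (\<lambda>i. {t i}) ?K"
        by (rule inj_onI) (use inj_onD[OF t(1)] in blast)
      ultimately show ?thesis unfolding P_def a_def c_def by (simp add: sum.reindex)
    qed
    moreover have "measure chi (unit_I - ?T) = 0"
      using supp space_nonneg_measure_I[OF chi] by (simp add: supported_on_def measure_def)
    ultimately show ?thesis by simp
  qed
  have terms: "sum a ?K + sum r ?K - 2 * sum w ?K \<le> (\<Sum>i\<in>?K. \<bar>c i - a i\<bar>) + (\<Sum>i\<in>?K. \<bar>c i - r i\<bar>)"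
  proof -
    have "(\<Sum>i\<in>?K. a i + r i - 2 * w i) \<le> (\<Sum>i\<in>?K. \<bar>c i - a i\<bar> + \<bar>c i - r i\<bar>)"
      by (intro sum_mono) (auto simp: w_def min_def)
    then show ?thesis by (simp add: sum.distrib sum_subtractf sum_distrib_left)
  qed
  have "sum w ?K \<le> sum c ?K" by (intro sum_mono) (auto simp: w_def)
  then have "\<epsilon> * sum w ?K \<le> \<epsilon> * measure chi unit_I"
    using chi_mass \<epsilon> by (intro mult_left_mono) auto
  moreover have "d_GW x y \<le> tv_norm (\<lambda>A. measure x A - measure w1 A) + transport_cost \<gamma>'
           + tv_norm (\<lambda>A. measure y A - measure w2 A)"
    by (rule d_GW_le[OF x y w12])
  moreover have "tv_norm (\<lambda>A. measure x A - measure w1 A)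
     \<le> tv_norm (\<lambda>A. measure x A - measure z1 A) + (measure z1 unit_I - measure w1 unit_I)"
    by (rule tv_norm_diff_submeasure[OF x z(1) w12(1) bspec[OF le1]])
  moreover have "tv_norm (\<lambda>A. measure y A - measure w2 A) \<le> measure y unit_I - measure w2 unit_I"
    using tv_norm_diff_submeasure[OF y y w12(2) bspec[OF le2]] tv_norm_self_diff[OF y] by simp
  ultimately show "d_GW x y \<le> ?rhs + e"
    using opt cost[unfolded W] terms tv_chi split_z2 split_y W W1
    unfolding c_def[symmetric] r_def[symmetric] by linarith
qed

section \<open>Interpolation and positivity in T-systems\<close>

abbreviation gpoly :: "nat \<Rightarrow> (nat \<Rightarrow> real \<Rightarrow> real) \<Rightarrow> (nat \<Rightarrow> real) \<Rightarrow> real \<Rightarrow> real" where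
  "gpoly m \<phi> b s \<equiv> (\<Sum>j\<in>{1..m}. b j * \<phi> j s)"

lemma gpoly_add_scaled: "gpoly m \<phi> (\<lambda>j. a j + c * b j) s = gpoly m \<phi> a s + c * gpoly m \<phi> b s"
  by (simp add: distrib_right sum.distrib sum_distrib_left mult.assoc)

lemma continuous_on_gpoly:
  assumes "\<And>j. j \<in> {1..m} \<Longrightarrow> continuous_on S (\<phi> j)"
  shows "continuous_on S (gpoly m \<phi> b)"
  using assms by (intro continuous_intros) auto

lemma ex_increasing_enumeration:
  fixes Z :: "'a :: linorder set"
  assumes "finite Z"
  obtains \<sigma> where "bij_betw \<sigma> {..<card Z} Z" "strict_mono_on {..<card Z} \<sigma>"
proof -
  let ?xs = "sorted_list_of_set Z"
  have len: "length ?xs = card Z" by simp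
  have "sorted_wrt (<) ?xs" by simp
  then have "strict_mono_on {..<card Z} (nth ?xs)"
    using len by (auto simp: strict_mono_on_def sorted_wrt_iff_nth_less)
  moreover have "bij_betw (nth ?xs) {..<card Z} Z"
    by (rule bij_betw_nth) (use assms len in auto)
  ultimately show ?thesis using that by blast
qed

lemma T_system_det_nonzero:
  assumes "T_system m \<phi>" "strict_mono_on {..<m} \<sigma>" "\<sigma> ` {..<m} \<subseteq> unit_I"
  shows "Determinant.det (Matrix.mat m m (\<lambda>(l, j). \<phi> (Suc j) (\<sigma> l))) \<noteq> 0"
proof -
  have "strict_mono_on {1..m} (\<lambda>l. \<sigma> (l - 1))" "(\<lambda>l. \<sigma> (l - 1)) ` {1..m} \<subseteq> unit_I"
    using assms(3) by (auto simp: image_subset_iff intro!: strict_mono_onI strict_mono_onD[OF assms(2)])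
  with assms(1) have "Determinant.det (Matrix.mat m m (\<lambda>(l, j). \<phi> (Suc j) (\<sigma> (Suc l - 1)))) \<noteq> 0"
    unfolding T_system_def by blast
  then show ?thesis by simp
qed

lemma gpoly_eq_mat_mult:
  assumes "w \<in> carrier_vec m" "l < m"
  shows "vec_index (Matrix.mat m m (\<lambda>(l, j). \<phi> (Suc j) (\<sigma> l)) *\<^sub>v w) l
    = gpoly m \<phi> (\<lambda>j. vec_index w (j - 1)) (\<sigma> l)"
  using assms by (simp add: scalar_prod_def sum.atLeast1_atMost_eq atLeast0LessThan mult.commute)

text \<open>
  Solve the linear system with the adjugate matrix.
\<close>

lemma T_system_interpolation:
  assumes T: "T_system m \<phi>" and Z: "Z \<subseteq> unit_I" "card Z = m" "finite Z"
  shows "\<exists>b. \<forall>s\<in>Z. gpoly m \<phi> b s = v s"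
proof -
  obtain \<sigma> where \<sigma>: "bij_betw \<sigma> {..<m} Z" "strict_mono_on {..<m} \<sigma>"
    using ex_increasing_enumeration[OF Z(3)] Z(2) by blast
  then have im: "\<sigma> ` {..<m} = Z" by (simp add: bij_betw_def)
  let ?A = "Matrix.mat m m (\<lambda>(l, j). \<phi> (Suc j) (\<sigma> l))"
  have A: "?A \<in> carrier_mat m m" by simp
  have det: "Determinant.det ?A \<noteq> 0"
    using T_system_det_nonzero[OF T \<sigma>(2)] im Z(1) by simp
  let ?v = "Matrix.vec m (\<lambda>l. v (\<sigma> l))"
  define w where "w = inverse (Determinant.det ?A) \<cdot>\<^sub>v (adj_mat ?A *\<^sub>v ?v)"
  note adj = adj_mat[OF A]
  have w: "w \<in> carrier_vec m" using adj(1) by (simp add: w_def)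
  have "?A *\<^sub>v w = inverse (Determinant.det ?A) \<cdot>\<^sub>v (?A *\<^sub>v (adj_mat ?A *\<^sub>v ?v))"
    unfolding w_def using adj(1) by (intro mult_mat_vec[OF A]) simp
  also have "?A *\<^sub>v (adj_mat ?A *\<^sub>v ?v) = (?A * adj_mat ?A) *\<^sub>v ?v"
    using adj(1) by (intro assoc_mult_mat_vec[symmetric, OF A]) auto
  also have "\<dots> = Determinant.det ?A \<cdot>\<^sub>v ?v"
    unfolding adj(2) by (auto intro!: eq_vecI)
  finally have Aw: "?A *\<^sub>v w = ?v" using det by (simp add: smult_smult_assoc)
  have "gpoly m \<phi> (\<lambda>j. vec_index w (j - 1)) s = v s" if "s \<in> Z" for s
  proof -
    obtain l where "l < m" "s = \<sigma> l" using \<open>s \<in> Z\<close> im by auto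
    then show ?thesis using gpoly_eq_mat_mult[OF w, of l \<phi> \<sigma>] unfolding Aw by simp
  qed
  then show ?thesis by (intro exI ballI)
qed

lemma T_system_zeros:
  assumes T: "T_system m \<phi>" and Z: "Z \<subseteq> unit_I" "card Z = m" "finite Z"
    and zero: "\<And>s. s \<in> Z \<Longrightarrow> gpoly m \<phi> b s = 0" and j: "j \<in> {1..m}"
  shows "b j = 0"
proof -
  obtain \<sigma> where \<sigma>: "bij_betw \<sigma> {..<m} Z" "strict_mono_on {..<m} \<sigma>"
    using ex_increasing_enumeration[OF Z(3)] Z(2) by blast
  then have im: "\<sigma> ` {..<m} = Z" by (simp add: bij_betw_def)
  let ?A = "Matrix.mat m m (\<lambda>(l, j). \<phi> (Suc j) (\<sigma> l))"
  let ?w = "Matrix.vec m (\<lambda>j. b (Suc j))"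
  have "?A *\<^sub>v ?w = 0\<^sub>v m"
  proof (rule eq_vecI)
    fix l assume l: "l < dim_vec (0\<^sub>v m)"
    then have "vec_index (?A *\<^sub>v ?w) l = gpoly m \<phi> b (\<sigma> l)"
      by (subst gpoly_eq_mat_mult) (auto intro!: sum.cong)
    then show "vec_index (?A *\<^sub>v ?w) l = vec_index (0\<^sub>v m) l" using zero[of "\<sigma> l"] im l by auto
  qed simp
  then have "?w = 0\<^sub>v m"
    using T_system_det_nonzero[OF T \<sigma>(2)] im Z(1) det_0_iff_vec_prod_zero_field[of ?A m]
      vec_carrier[of m "\<lambda>j. b (Suc j)"] mat_carrier by metis
  moreover have "j - 1 < m" using j by auto
  ultimately have "b (Suc (j - 1)) = 0" by (metis index_vec index_zero_vec(1))
  then show ?thesis using j by simp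
qed

lemma bounded_coeffs_convergent_subsequence:
  fixes B :: "nat \<Rightarrow> nat \<Rightarrow> real"
  assumes "\<And>n j. j \<in> {1..m} \<Longrightarrow> \<bar>B n j\<bar> \<le> C"
  obtains b and r :: "nat \<Rightarrow> nat" where "strict_mono r"
    "\<forall>j\<in>{1..m}. (\<lambda>n. B (r n) j) \<longlonglongrightarrow> b j"
    "\<forall>\<phi> s. (\<lambda>n. gpoly m \<phi> (B (r n)) s) \<longlonglongrightarrow> gpoly m \<phi> b s"
proof -
  obtain r :: "nat \<Rightarrow> nat" where r: "strict_mono r" "\<And>j. j \<in> {1..m} \<Longrightarrow> \<exists>l. (\<lambda>n. B (r n) j) \<longlonglongrightarrow> l"
    by (rule function_convergent_subsequence[of "{1..m}" B C]) (use assms in auto)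
  then obtain b where b: "\<And>j. j \<in> {1..m} \<Longrightarrow> (\<lambda>n. B (r n) j) \<longlonglongrightarrow> b j" by metis
  show ?thesis
    by (rule that[OF r(1)]) (auto intro!: tendsto_sum tendsto_mult_right b)
qed

text \<open>
  Let \<open>m - 1\<close> zeros accumulate at \<open>0\<close>.  A nontrivial polynomial with these zeros cannot vanish to the right of them,
  so it has a constant sign there; normalise its coefficients and pass to a limit.
\<close>

lemma T_system_nonneg_gpoly:
  assumes T: "T_system m \<phi>" and m: "1 \<le> m"
  shows "\<exists>b. (\<exists>j\<in>{1..m}. b j \<noteq> 0) \<and> (\<forall>s\<in>unit_I. 0 \<le> gpoly m \<phi> b s)"
proof -
  have cont: "continuous_on unit_I (gpoly m \<phi> b)" for b
    using T by (intro continuous_on_gpoly) (auto simp: T_system_def)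
  have "\<exists>B. (\<Sum>j\<in>{1..m}. \<bar>B j\<bar>) = 1 \<and> (\<forall>s\<in>{1 / real (Suc n)..1}. 0 \<le> gpoly m \<phi> B s)" for n
  proof -
    define Y where "Y = (\<lambda>i. real i / (real m * real (Suc n))) ` {..<m - 1}"
    have Y_less: "y < 1 / real (Suc n)" if "y \<in> Y" for y
    proof -
      obtain i where i: "i < m - 1" "y = real i / (real m * real (Suc n))"
        using \<open>y \<in> Y\<close> by (auto simp: Y_def)
      then have "y = (real i / real m) / real (Suc n)" by simp
      also have "\<dots> < 1 / real (Suc n)" using i by (intro divide_strict_right_mono) auto
      finally show ?thesis .
    qed
    have n1: "1 / real (Suc n) \<le> 1" by simp
    have Y: "Y \<subseteq> unit_I" "finite Y" "card Y = m - 1"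
    proof -
      have "0 \<le> y" if "y \<in> Y" for y using that by (auto simp: Y_def)
      then show "Y \<subseteq> unit_I"
        using Y_less n1 by (meson atLeastAtMost_iff less_le_trans less_imp_le subsetI)
      show "finite Y" by (simp add: Y_def)
      have "inj_on (\<lambda>i. real i / (real m * real (Suc n))) {..<m - 1}"
        using m by (auto simp: inj_on_def)
      then show "card Y = m - 1" unfolding Y_def by (simp add: card_image)
    qed
    have one: "1 \<notin> Y" using Y_less[of 1] n1 by linarith
    have Y1: "insert 1 Y \<subseteq> unit_I" "card (insert 1 Y) = m" "finite (insert 1 Y)"
      using Y one m by auto
    obtain b where b: "\<And>s. s \<in> insert 1 Y \<Longrightarrow> gpoly m \<phi> b s = (if s = 1 then 1 else 0)"
      using T_system_interpolation[OF T Y1, of "\<lambda>s. if s = 1 then 1 else 0"] by blast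
    have bY: "gpoly m \<phi> b y = 0" if "y \<in> Y" for y using b[of y] that one by auto
    have b1: "gpoly m \<phi> b 1 = 1" using b by simp
    \<comment> \<open>Normalising the sum of the moduli keeps the limit from vanishing identically.\<close>
    define N where "N = (\<Sum>j\<in>{1..m}. \<bar>b j\<bar>)"
    have "N \<noteq> 0"
    proof
      assume "N = 0"
      then have "\<forall>j\<in>{1..m}. b j = 0" by (simp add: N_def sum_nonneg_eq_0_iff)
      then show False using b1 by simp
    qed
    moreover have "0 \<le> N" by (simp add: N_def sum_nonneg)
    ultimately have N: "0 < N" by simp
    have nonneg: "0 \<le> gpoly m \<phi> b s" if s: "s \<in> {1 / real (Suc n)..1}" for s
    proof (rule ccontr)
      assume neg: "\<not> 0 \<le> gpoly m \<phi> b s"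
      have "0 < 1 / real (Suc n)" by simp
      then have sI: "0 \<le> s" "s \<le> 1" using s unfolding atLeastAtMost_iff by linarith+
      have "continuous_on {s..1} (gpoly m \<phi> b)"
        by (rule continuous_on_subset[OF cont]) (use sI in auto)
      then obtain z where z: "s \<le> z" "z \<le> 1" "gpoly m \<phi> b z = 0"
        using IVT'[of "gpoly m \<phi> b" s 0 1] neg b1 sI by auto
      have "z \<notin> Y" using Y_less[of z] z(1) s by auto
      then have "card (insert z Y) = m" using Y m by auto
      then have "b j = 0" if "j \<in> {1..m}" for j
        using T_system_zeros[OF T, of "insert z Y" b j] Y z bY sI that by auto
      then show False using b1 by simp
    qed
    have "(\<Sum>j\<in>{1..m}. \<bar>b j / N\<bar>) = (\<Sum>j\<in>{1..m}. \<bar>b j\<bar>) / N"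
      using N by (simp add: sum_divide_distrib)
    then have "(\<Sum>j\<in>{1..m}. \<bar>b j / N\<bar>) = 1" using N unfolding N_def[symmetric] by simp
    moreover have "gpoly m \<phi> (\<lambda>j. b j / N) s = gpoly m \<phi> b s / N" for s
      by (simp add: sum_divide_distrib)
    ultimately show ?thesis using nonneg N by (intro exI[of _ "\<lambda>j. b j / N"]) auto
  qed
  then obtain B where B: "\<And>n. (\<Sum>j\<in>{1..m}. \<bar>B n j\<bar>) = 1"
    "\<And>n s. s \<in> {1 / real (Suc n)..1} \<Longrightarrow> 0 \<le> gpoly m \<phi> (B n) s" by metis
  have bound: "\<bar>B n j\<bar> \<le> 1" if "j \<in> {1..m}" for n j
    using member_le_sum[OF that, of "\<lambda>j. \<bar>B n j\<bar>"] B(1) by simp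
  obtain b and r :: "nat \<Rightarrow> nat" where r: "strict_mono r"
    and lim: "\<forall>j\<in>{1..m}. (\<lambda>n. B (r n) j) \<longlonglongrightarrow> b j"
    and lim_poly: "\<forall>\<phi> s. (\<lambda>n. gpoly m \<phi> (B (r n)) s) \<longlonglongrightarrow> gpoly m \<phi> b s"
    by (rule bounded_coeffs_convergent_subsequence[of m B 1, OF bound]) (assumption, (rule that; assumption))
  have "(\<lambda>n. \<Sum>j\<in>{1..m}. \<bar>B (r n) j\<bar>) \<longlonglongrightarrow> (\<Sum>j\<in>{1..m}. \<bar>b j\<bar>)"
    by (intro tendsto_sum tendsto_rabs bspec[OF lim])
  then have "(\<Sum>j\<in>{1..m}. \<bar>b j\<bar>) = 1" unfolding B(1) by (simp add: LIMSEQ_const_iff)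
  then have nz: "\<exists>j\<in>{1..m}. b j \<noteq> 0" by (metis abs_zero sum.neutral zero_neq_one)
  have pos: "0 \<le> gpoly m \<phi> b s" if "s \<in> {0<..1}" for s
  proof (rule LIMSEQ_le_const[OF spec[OF spec[OF lim_poly]]])
    obtain n0 where n0: "1 / real (Suc n0) < s"
      using \<open>s \<in> {0<..1}\<close> by (auto elim: nat_approx_posE)
    have "0 \<le> gpoly m \<phi> (B (r n)) s" if "n \<ge> n0" for n
    proof (rule B(2))
      have "n0 \<le> r n" using that seq_suble[OF r, of n] by simp
      then have "1 / real (Suc (r n)) \<le> 1 / real (Suc n0)" by (intro divide_left_mono) auto
      then show "s \<in> {1 / real (Suc (r n))..1}" using n0 \<open>s \<in> {0<..1}\<close> by auto
    qed
    then show "\<exists>N. \<forall>n\<ge>N. 0 \<le> gpoly m \<phi> (B (r n)) s" by blast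
  qed
  have "0 \<le> gpoly m \<phi> b s" if "s \<in> unit_I" for s
  proof -
    have "closure {0<..<1::real} = unit_I" by simp
    then show ?thesis
      using continuous_ge_on_closure[of "{0<..<1}" "gpoly m \<phi> b" s 0] cont pos that by auto
  qed
  with nz show ?thesis by blast
qed

text \<open>
  A non-negative nontrivial polynomial has fewer than \<open>m\<close> zeros.  Adding a small multiple of a polynomial
  that interpolates \<open>1\<close> at all of them lifts it above zero.
\<close>

lemma T_system_positive_gpoly:
  assumes T: "T_system m \<phi>" and m: "1 \<le> m"
  shows "\<exists>b. \<forall>s\<in>unit_I. 0 < gpoly m \<phi> b s"
proof -
  have cont: "continuous_on unit_I (gpoly m \<phi> b)" for b
    using T by (intro continuous_on_gpoly) (auto simp: T_system_def)
  obtain b j where b: "j \<in> {1..m}" "b j \<noteq> 0" "\<And>s. s \<in> unit_I \<Longrightarrow> 0 \<le> gpoly m \<phi> b s"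
    using T_system_nonneg_gpoly[OF T m] by blast
  define Z where "Z = {s \<in> unit_I. gpoly m \<phi> b s = 0}"
  have few: "finite Z \<and> card Z < m"
  proof (rule ccontr)
    assume "\<not> (finite Z \<and> card Z < m)"
    then obtain Z' where "Z' \<subseteq> Z" "card Z' = m" "finite Z'"
      by (metis infinite_arbitrarily_large linorder_not_less obtain_subset_with_card_n)
    then show False
      using T_system_zeros[OF T, of Z' b j] b(1,2) unfolding Z_def by blast
  qed
  have "infinite (unit_I - Z)" using few by (simp add: infinite_Icc Diff_infinite_finite)
  then obtain Y where Y: "Y \<subseteq> unit_I - Z" "finite Y" "card Y = m - card Z"
    using infinite_arbitrarily_large by blast
  have ZY: "card (Z \<union> Y) = m" using few Y by (subst card_Un_disjoint) auto
  have "Z \<union> Y \<subseteq> unit_I" "finite (Z \<union> Y)" using few Y by (auto simp: Z_def)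
  then obtain p where p: "\<And>s. s \<in> Z \<union> Y \<Longrightarrow> gpoly m \<phi> p s = 1"
    using T_system_interpolation[OF T _ ZY, of "\<lambda>_. 1"] by blast
  define K where "K = {s \<in> unit_I. gpoly m \<phi> p s \<le> 1 / 2}"
  have "\<exists>\<tau>>0. \<forall>s\<in>K. 0 < gpoly m \<phi> b s + \<tau> * gpoly m \<phi> p s"
  proof (cases "K = {}")
    case False
    have "closed K" unfolding K_def
      using continuous_closed_preimage[OF cont, of "{..1/2}" p] by (simp add: vimage_def Int_def)
    then have "compact ({0..1} \<inter> K)" by (intro compact_Int_closed) auto
    moreover have "{0..1} \<inter> K = K" by (auto simp: K_def)
    ultimately have K: "compact K" by simp
    have contK: "continuous_on K (gpoly m \<phi> a)" for a
      by (rule continuous_on_subset[OF cont]) (auto simp: K_def)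
    obtain s0 where s0: "s0 \<in> K" "\<And>s. s \<in> K \<Longrightarrow> gpoly m \<phi> b s0 \<le> gpoly m \<phi> b s"
      using continuous_attains_inf[OF K False contK] by blast
    define c where "c = gpoly m \<phi> b s0"
    have "s0 \<notin> Z" using p[of s0] s0(1) by (auto simp: K_def)
    then have c: "0 < c" using b(3)[of s0] s0(1) by (auto simp: c_def Z_def K_def less_le)
    obtain s1 where s1: "\<And>s. s \<in> K \<Longrightarrow> gpoly m \<phi> p s1 \<le> gpoly m \<phi> p s"
      using continuous_attains_inf[OF K False contK] by blast
    define C where "C = \<bar>gpoly m \<phi> p s1\<bar> + 1"
    have C: "0 < C" by (simp add: C_def)
    have "0 < gpoly m \<phi> b s + c / C * gpoly m \<phi> p s" if "s \<in> K" for s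
    proof -
      have "- C < gpoly m \<phi> p s" using s1[OF that] by (simp add: C_def)
      then have "c / C * (- C) < c / C * gpoly m \<phi> p s" using c C by (intro mult_strict_left_mono) auto
      then show ?thesis using s0(2)[OF that] C by (simp add: c_def)
    qed
    then show ?thesis using c C by (intro exI[of _ "c / C"]) auto
  qed (auto intro: exI[of _ 1])
  then obtain \<tau> where \<tau>: "0 < \<tau>" "\<And>s. s \<in> K \<Longrightarrow> 0 < gpoly m \<phi> b s + \<tau> * gpoly m \<phi> p s"
    by (elim exE conjE) (rule that, assumption, erule bspec)
  have "0 < gpoly m \<phi> b s + \<tau> * gpoly m \<phi> p s" if s: "s \<in> unit_I" for s
  proof (cases "s \<in> K")
    case False
    then have "0 < \<tau> * gpoly m \<phi> p s" using s \<tau>(1) by (auto simp: K_def)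
    then show ?thesis using b(3)[OF s] by simp
  qed (rule \<tau>(2))
  then show ?thesis
    by (intro exI[of _ "\<lambda>j. b j + \<tau> * p j"] ballI) (simp only: gpoly_add_scaled)
qed

section \<open>Separation of the support points\<close>

lemma min_sep_le:
  assumes "finite T" "s \<in> T \<union> {0, 1}" "s' \<in> T \<union> {0, 1}" "s \<noteq> s'"
  shows "min_sep T \<le> \<bar>s - s'\<bar>"
proof -
  let ?D = "{\<bar>s - s'\<bar> | s s'. s \<in> T \<union> {0, 1} \<and> s' \<in> T \<union> {0, 1} \<and> s \<noteq> s'}"
  have "?D \<subseteq> (\<lambda>(s, s'). \<bar>s - s'\<bar>) ` ((T \<union> {0, 1}) \<times> (T \<union> {0, 1}))" by auto
  then have "finite ?D" by (rule finite_subset) (use assms(1) in simp)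
  then show ?thesis unfolding min_sep_def using assms(2-4) by (intro Min_le) blast+
qed

lemma in_nbhdsI: "i \<in> {1..k} \<Longrightarrow> s \<in> nbhd t \<rho> i \<Longrightarrow> s \<in> nbhds k t \<rho>"
  unfolding nbhds_def by blast

text \<open>
  All geometric facts used below follow from the separation condition: the points of \<open>T\<close> have
  distance at least \<open>2\<epsilon>\<close> from each other and from the end points.
\<close>

locale separated_support =
  fixes k :: nat and t :: "nat \<Rightarrow> real" and \<epsilon> :: real
  assumes inj: "inj_on t {1..k}" and interior: "t ` {1..k} \<subseteq> {0<..<1}"
    and \<epsilon>_pos: "0 < \<epsilon>" and \<epsilon>_le: "\<epsilon> \<le> min_sep (t ` {1..k}) / 2"
begin

lemma t_range: "i \<in> {1..k} \<Longrightarrow> 2 * \<epsilon> \<le> t i" "i \<in> {1..k} \<Longrightarrow> t i \<le> 1 - 2 * \<epsilon>"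
proof -
  assume i: "i \<in> {1..k}"
  have ti: "t i \<in> {0<..<1}" by (rule subsetD[OF interior imageI[OF i]])
  then show "2 * \<epsilon> \<le> t i"
    using min_sep_le[of "t ` {1..k}" "t i" 0] i \<epsilon>_le by auto
  show "t i \<le> 1 - 2 * \<epsilon>"
    using min_sep_le[of "t ` {1..k}" "t i" 1] ti i \<epsilon>_le by auto
qed

lemma t_separated:
  assumes "i \<in> {1..k}" "j \<in> {1..k}" "i \<noteq> j"
  shows "2 * \<epsilon> \<le> \<bar>t i - t j\<bar>"
  using min_sep_le[of "t ` {1..k}" "t i" "t j"] inj_onD[OF inj, of i j] assms \<epsilon>_le by fastforce

lemma \<epsilon>_half: "\<epsilon> \<le> 1 / 2"
  using min_sep_le[of "t ` {1..k}" 0 1] \<epsilon>_le by simp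

lemma nbhd_disjoint:
  assumes "i \<in> {1..k}" "j \<in> {1..k}" "\<rho> < \<epsilon>" "s \<in> nbhd t \<rho> i" "s \<in> nbhd t \<rho> j"
  shows "i = j"
proof (rule ccontr)
  assume "i \<noteq> j"
  then show False using t_separated[of i j] assms by (auto simp: nbhd_def abs_if split: if_splits)
qed

lemma not_in_nbhds_near_ends:
  assumes "\<rho> \<le> \<epsilon>" "s < \<epsilon> \<or> 1 - \<epsilon> < s"
  shows "s \<notin> nbhds k t \<rho>"
proof
  assume "s \<in> nbhds k t \<rho>"
  then obtain i where "i \<in> {1..k}" "\<bar>s - t i\<bar> \<le> \<rho>" by (auto simp: nbhds_def nbhd_def)
  then show False using t_range[of i] assms by (auto simp: abs_if split: if_splits)
qed

lemma t_in_nbhd: "i \<in> {1..k} \<Longrightarrow> 0 \<le> \<rho> \<Longrightarrow> t i \<in> nbhd t \<rho> i"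
  using t_range[of i] \<epsilon>_pos by (auto simp: nbhd_def)

lemma nbhd_index_props:
  assumes "s \<in> nbhds k t \<epsilon>"
  shows "nbhd_index k t \<epsilon> s \<in> {1..k}" "s \<in> nbhd t \<epsilon> (nbhd_index k t \<epsilon> s)"
proof -
  have "\<exists>i. i \<in> {1..k} \<and> s \<in> nbhd t \<epsilon> i" using assms by (auto simp: nbhds_def)
  from someI_ex[OF this]
  show "nbhd_index k t \<epsilon> s \<in> {1..k}" "s \<in> nbhd t \<epsilon> (nbhd_index k t \<epsilon> s)"
    unfolding nbhd_index_def by blast+
qed

lemma nbhd_index_t:
  assumes "i \<in> {1..k}"
  shows "nbhd_index k t \<epsilon> (t i) = i"
proof (rule ccontr)
  have "t i \<in> nbhds k t \<epsilon>" using in_nbhdsI[OF assms t_in_nbhd[OF assms]] \<epsilon>_pos by simp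
  note p = nbhd_index_props[OF this]
  assume "nbhd_index k t \<epsilon> (t i) \<noteq> i"
  from t_separated[OF assms p(1) this[symmetric]] p(2) show False
    using \<epsilon>_pos by (auto simp: nbhd_def)
qed

text \<open>
  Neighbourhoods of radius \<open>\<epsilon>\<close> may share end points.  Assigning these as the separators do makes the
  neighbourhoods a partition.
\<close>

definition region :: "nat \<Rightarrow> real set" where
  "region i = {s \<in> nbhds k t \<epsilon>. nbhd_index k t \<epsilon> s = i}"

lemma region_subset: "region i \<subseteq> nbhd t \<epsilon> i"
  using nbhd_index_props by (auto simp: region_def)

lemma Union_region: "(\<Union>i\<in>{1..k}. region i) = nbhds k t \<epsilon>"
  using nbhd_index_props(1) by (auto simp: region_def)

lemma disjoint_region: "disjoint_family_on region {1..k}"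
  by (auto simp: disjoint_family_on_def region_def)

text \<open>
  The arbitrary choice at shared end points affects only finitely many points, namely midpoints of
  pairs of support points.
\<close>

lemma region_sets:
  assumes i: "i \<in> {1..k}"
  shows "region i \<in> sets borel_I"
proof -
  let ?M = "(\<lambda>j. (t i + t j) / 2) ` {1..k}"
  have "nbhd t \<epsilon> i - region i \<subseteq> ?M"
  proof
    fix s assume s: "s \<in> nbhd t \<epsilon> i - region i"
    let ?j = "nbhd_index k t \<epsilon> s"
    have sn: "s \<in> nbhds k t \<epsilon>" using s i by (auto simp: nbhds_def)
    note p = nbhd_index_props[OF sn]
    have "?j \<noteq> i" using s sn by (auto simp: region_def)
    then have "2 * \<epsilon> \<le> \<bar>t i - t ?j\<bar>" using t_separated[OF i p(1)] by simp
    moreover have "\<bar>s - t i\<bar> \<le> \<epsilon>" "\<bar>s - t ?j\<bar> \<le> \<epsilon>" using s p(2) by (auto simp: nbhd_def)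
    ultimately have "s = (t i + t ?j) / 2" by (auto simp: abs_if split: if_splits)
    then show "s \<in> ?M" using p(1) by (rule image_eqI)
  qed
  then have "finite (nbhd t \<epsilon> i - region i)" by (rule finite_subset) simp
  moreover have "region i = nbhd t \<epsilon> i - (nbhd t \<epsilon> i - region i)" using region_subset by blast
  moreover have "nbhd t \<epsilon> i = unit_I \<inter> {t i - \<epsilon>..t i + \<epsilon>}" by (auto simp: nbhd_def)
  ultimately have "region i \<in> sets borel"
    by (metis closed_Int closed_atLeastAtMost borel_closed finite_imp_closed sets.Diff)
  moreover have "region i \<subseteq> unit_I" using region_subset[of i] by (auto simp: nbhd_def)
  ultimately show ?thesis by (auto simp: sets_restrict_space intro!: image_eqI[of _ _ "region i"])
qed

end

section \<open>Clustered node sequences\<close>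

definition insert_node :: "(nat \<Rightarrow> real) \<Rightarrow> nat \<Rightarrow> real \<Rightarrow> nat \<Rightarrow> real" where
  "insert_node \<sigma> l s n = (if n < l then \<sigma> n else if n = l then s else \<sigma> (n - 1))"

text \<open>
  The points \<open>j / n\<close> with \<open>j < n\<close> place the first member of the cluster at \<open>t i\<close> itself.  This makes
  the interpolants exact on \<open>T\<close> for every \<open>\<rho>\<close>, and the equality survives in the limit although \<open>f\<close> may jump
  at \<open>0\<close>.
\<close>

definition cluster :: "(nat \<Rightarrow> real) \<Rightarrow> nat \<Rightarrow> real \<Rightarrow> nat \<Rightarrow> real set" where
  "cluster t n \<rho> i = (\<lambda>j. t i + \<rho> * real j / real n) ` {..<n}"

text \<open>
  Two nodes per support point, except that the first cluster absorbs all surplus nodes; the sizes are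
  even when \<open>m\<close> is.
\<close>

definition cluster_size :: "nat \<Rightarrow> nat \<Rightarrow> nat \<Rightarrow> nat" where
  "cluster_size k m i = (if i = 1 then m - 2 * k else 2)"

definition node_set :: "nat \<Rightarrow> (nat \<Rightarrow> real) \<Rightarrow> nat \<Rightarrow> real \<Rightarrow> real set" where
  "node_set k t m \<rho> = {0, 1} \<union> (\<Union>i\<in>{1..k}. cluster t (cluster_size k m i) \<rho> i)"

lemma card_cluster: "0 < \<rho> \<Longrightarrow> card (cluster t n \<rho> i) = n"
  unfolding cluster_def by (subst card_image) (auto simp: inj_on_def)

lemma cluster_bounds:
  assumes "0 < \<rho>" "s \<in> cluster t n \<rho> i"
  shows "t i \<le> s" "s < t i + \<rho>"
proof -
  obtain j where j: "j < n" "s = t i + \<rho> * (real j / real n)" using assms(2) by (auto simp: cluster_def)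
  then show "t i \<le> s" using assms(1) by simp
  have "real j / real n < 1" using j(1) by simp
  then have "\<rho> * (real j / real n) < \<rho> * 1" using assms(1) by (rule mult_strict_left_mono)
  then show "s < t i + \<rho>" using j by simp
qed

lemma sum_cluster_size:
  assumes "1 \<le> k" "2 * k + 2 \<le> m"
  shows "(\<Sum>i\<in>{1..k}. cluster_size k m i) = m - 2"
proof -
  have "{1..k} = insert 1 {2..k}" using assms(1) by auto
  then show ?thesis using assms by (simp add: cluster_size_def)
qed

context separated_support
begin

lemma cluster_in_nbhd:
  assumes "i \<in> {1..k}" "0 < \<rho>" "\<rho> < \<epsilon>"
  shows "cluster t n \<rho> i \<subseteq> nbhd t \<rho> i"
  using cluster_bounds[OF assms(2), of _ t n i] t_range[OF assms(1)] assms(2,3)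
  by (fastforce simp: nbhd_def)

lemma clusters_disjoint:
  assumes "0 < \<rho>" "\<rho> < \<epsilon>"
  shows "disjoint_family_on (\<lambda>i. cluster t (cluster_size k m i) \<rho> i) {1..k}"
  unfolding disjoint_family_on_def using cluster_in_nbhd[OF _ assms] nbhd_disjoint[OF _ _ assms(2)] by blast

text \<open>
  Every cluster lies entirely on one side of a point outside the neighbourhoods.  To the left of such a
  point there are thus the node \<open>0\<close> and an even number of others, which is the parity that fixes the sign
  of the determinant.
\<close>

lemma node_set_props:
  assumes k: "1 \<le> k" and m: "2 * k + 2 \<le> m" "even m" and \<rho>: "0 < \<rho>" "\<rho> < \<epsilon>"
  defines "N \<equiv> node_set k t m \<rho>"
  shows "finite N" "card N = m" "N \<subseteq> unit_I" "N - {0, 1} \<subseteq> nbhds k t \<rho>"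
    "t ` {1..k} \<subseteq> N"
    "\<And>i. i \<in> {1..k} \<Longrightarrow> even (card (N \<inter> nbhd t \<rho> i))"
    "\<And>s. s \<in> {0<..<1} \<Longrightarrow> s \<notin> nbhds k t \<rho> \<Longrightarrow> odd (card (N \<inter> {..<s}))"
    "\<And>s. 0 < s \<Longrightarrow> s < \<epsilon> \<Longrightarrow> N \<inter> {..<s} = {0}"
proof -
  let ?C = "\<lambda>i. cluster t (cluster_size k m i) \<rho> i"
  have C_nbhd: "?C i \<subseteq> nbhd t \<rho> i" if "i \<in> {1..k}" for i using cluster_in_nbhd[OF that \<rho>] .
  have fin: "finite (?C i)" for i by (simp add: cluster_def)
  have card: "card (?C i) = cluster_size k m i" for i by (rule card_cluster[OF \<rho>(1)])
  have even: "even (cluster_size k m i)" for i using m by (simp add: cluster_size_def)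
  have ends: "0 \<notin> nbhds k t \<rho>" "1 \<notin> nbhds k t \<rho>"
    using not_in_nbhds_near_ends[of \<rho>] \<rho> by auto
  have UC: "(\<Union>i\<in>{1..k}. ?C i) \<subseteq> nbhds k t \<rho>" using C_nbhd in_nbhdsI by blast
  have card_U: "card (\<Union>i\<in>J. ?C i) = (\<Sum>i\<in>J. cluster_size k m i)" if "J \<subseteq> {1..k}" for J
  proof -
    have "disjoint_family_on ?C J"
      using clusters_disjoint[OF \<rho>, of m] that by (rule disjoint_family_on_mono[rotated])
    then have "card (\<Union>i\<in>J. ?C i) = (\<Sum>i\<in>J. card (?C i))"
      using that finite_subset[OF that] fin by (intro card_UN_disjoint) (auto simp: disjoint_family_on_def)
    then show ?thesis by (simp add: card)
  qed
  show "finite N" using fin by (simp add: N_def node_set_def)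
  have "card N = card {0, 1 :: real} + card (\<Union>i\<in>{1..k}. ?C i)"
    unfolding N_def node_set_def using UC ends fin by (intro card_Un_disjoint) auto
  then show "card N = m" using card_U[of "{1..k}"] sum_cluster_size[OF k m(1)] m(1) by simp
  show "N - {0, 1} \<subseteq> nbhds k t \<rho>" using UC by (auto simp: N_def node_set_def)
  have "nbhds k t \<rho> \<subseteq> unit_I" by (auto simp: nbhds_def nbhd_def)
  then show "N \<subseteq> unit_I" using UC by (auto simp: N_def node_set_def)
  show "t ` {1..k} \<subseteq> N"
  proof
    fix s assume "s \<in> t ` {1..k}"
    then obtain i where i: "i \<in> {1..k}" "s = t i" by auto
    have "0 < cluster_size k m i" using m by (simp add: cluster_size_def)
    then have "s \<in> ?C i" using i(2) by (auto simp: cluster_def intro!: image_eqI[of _ _ 0])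
    then show "s \<in> N" using i(1) by (auto simp: N_def node_set_def)
  qed
  show "even (card (N \<inter> nbhd t \<rho> i))" if i: "i \<in> {1..k}" for i
  proof -
    have "N \<inter> nbhd t \<rho> i = ?C i"
    proof
      show "?C i \<subseteq> N \<inter> nbhd t \<rho> i" using C_nbhd[OF i] i by (auto simp: N_def node_set_def)
      show "N \<inter> nbhd t \<rho> i \<subseteq> ?C i"
      proof
        fix s assume s: "s \<in> N \<inter> nbhd t \<rho> i"
        then have "s \<in> nbhds k t \<rho>" using i by (auto simp: nbhds_def)
        then obtain j where j: "j \<in> {1..k}" "s \<in> ?C j"
          using s ends by (auto simp: N_def node_set_def)
        then have "i = j" using nbhd_disjoint[OF i j(1) \<rho>(2), of s] s C_nbhd by blast
        then show "s \<in> ?C i" using j by simp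
      qed
    qed
    then show ?thesis using card even by simp
  qed
  show "odd (card (N \<inter> {..<s}))" if s: "s \<in> {0<..<1}" "s \<notin> nbhds k t \<rho>" for s
  proof -
    let ?J = "{i \<in> {1..k}. t i < s}"
    have below: "v < s \<longleftrightarrow> t i < s" if i: "i \<in> {1..k}" and v: "v \<in> ?C i" for i v
    proof -
      have "s \<notin> nbhd t \<rho> i" using s(2) i by (auto simp: nbhds_def)
      then have "\<rho> < \<bar>s - t i\<bar>" using s(1) by (auto simp: nbhd_def)
      then show ?thesis using cluster_bounds[OF \<rho>(1) v] \<rho>(1) by (auto simp: abs_if split: if_splits)
    qed
    have "N \<inter> {..<s} = insert 0 (\<Union>i\<in>?J. ?C i)"
      unfolding N_def node_set_def using s(1) below by auto
    moreover have "0 \<notin> (\<Union>i\<in>?J. ?C i)" using UC ends(1) by blast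
    moreover have "finite (\<Union>i\<in>?J. ?C i)" using fin by simp
    ultimately have "card (N \<inter> {..<s}) = Suc (card (\<Union>i\<in>?J. ?C i))" by simp
    then have "card (N \<inter> {..<s}) = Suc (\<Sum>i\<in>?J. cluster_size k m i)"
      by (subst (asm) card_U) auto
    moreover have "even (\<Sum>i\<in>?J. cluster_size k m i)" using even by (intro dvd_sum) auto
    ultimately show ?thesis by simp
  qed
  show "N \<inter> {..<s} = {0}" if "0 < s" "s < \<epsilon>" for s
  proof -
    have "v \<ge> s" if "i \<in> {1..k}" "v \<in> ?C i" for i v
      using cluster_bounds(1)[OF \<rho>(1) that(2)] t_range(1)[OF that(1)] \<open>s < \<epsilon>\<close> \<open>0 < s\<close> by linarith
    then show ?thesis unfolding N_def node_set_def using that \<epsilon>_half by fastforce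
  qed
qed

text \<open>
  The index of the inserted point in the increasing order is the number of nodes below it.
\<close>

lemma admissible_insert_node:
  assumes \<sigma>: "strict_mono_on {..<m} \<sigma>" and N: "\<sigma> ` {..<m} = N" "N \<subseteq> unit_I" "{0, 1} \<subseteq> N"
    and nbhds: "N - {0, 1} \<subseteq> nbhds k t \<rho>" and \<rho>: "\<rho> < \<epsilon>"
    and even: "\<And>i. i \<in> {1..k} \<Longrightarrow> even (card (N \<inter> nbhd t \<rho> i))"
    and s: "s \<in> {0<..<1}" "s \<notin> nbhds k t \<rho>"
  shows "admissible k t m \<rho> (insert_node \<sigma> (card (N \<inter> {..<s})) s) (card (N \<inter> {..<s}))"
proof -
  have inj: "inj_on \<sigma> {..<m}" using \<sigma> by (rule strict_mono_on_imp_inj_on)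
  have ends: "0 \<notin> nbhds k t \<rho>" "1 \<notin> nbhds k t \<rho>"
    using not_in_nbhds_near_ends[of \<rho>] \<rho> \<epsilon>_pos by auto
  have sN: "s \<notin> N" using s nbhds by auto
  obtain n0 where n0: "n0 < m" "\<sigma> n0 = 0" using N(1,3) by (metis imageE insert_subset lessThan_iff)
  obtain n1 where n1: "n1 < m" "\<sigma> n1 = 1" using N(1,3) by (metis imageE insert_subset lessThan_iff)
  have \<sigma>I: "\<sigma> n \<in> unit_I" if "n < m" for n using N(1,2) that by auto
  have mono: "\<sigma> a \<le> \<sigma> b" if "a \<le> b" "b < m" for a b
    using strict_mono_onD[OF \<sigma>, of a b] that by (cases "a = b") auto
  \<comment> \<open>The position at which \<open>s\<close> enters: the nodes below \<open>s\<close> are exactly those with index below \<open>l\<close>.\<close>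
  define l where "l = (LEAST n. \<not> (n < m \<and> \<sigma> n < s))"
  have l_not: "\<not> (l < m \<and> \<sigma> l < s)" unfolding l_def
    by (rule LeastI[of "\<lambda>n. \<not> (n < m \<and> \<sigma> n < s)" m]) simp
  have below: "n < m \<and> \<sigma> n < s" if "n < l" for n using not_less_Least[of n "\<lambda>n. \<not> (n < m \<and> \<sigma> n < s)"] that
    by (auto simp: l_def)
  have above: "s < \<sigma> n" if "l \<le> n" "n < m" for n
  proof -
    have "s \<le> \<sigma> l" using l_not that by auto
    then have "s \<le> \<sigma> n" using mono[OF that] by simp
    then show ?thesis using sN N(1) that(2) by (auto simp: less_le)
  qed
  have l_less: "l < m" using below[of n1] n1 s(1) by (cases "n1 < l") auto
  have "N \<inter> {..<s} = \<sigma> ` {..<l}"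
  proof
    show "N \<inter> {..<s} \<subseteq> \<sigma> ` {..<l}"
    proof
      fix v assume v: "v \<in> N \<inter> {..<s}"
      then obtain n where n: "n < m" "v = \<sigma> n" using N(1) by auto
      then have "n < l" using above[of n] v by (cases "n < l") auto
      then show "v \<in> \<sigma> ` {..<l}" using n(2) by blast
    qed
    show "\<sigma> ` {..<l} \<subseteq> N \<inter> {..<s}" using below N(1) by auto
  qed
  moreover have "inj_on \<sigma> {..<l}" by (rule inj_on_subset[OF inj]) (use l_less in auto)
  ultimately have card_l: "card (N \<inter> {..<s}) = l" by (simp add: card_image)
  have l_pos: "0 < l" using above[of n0] n0 s(1) by (cases "l = 0") auto
  have \<sigma>0: "\<sigma> 0 = 0" using mono[of 0 n0] n0 \<sigma>I[of 0] by auto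
  have \<sigma>m: "\<sigma> (m - 1) = 1" using mono[of n1 "m - 1"] n1 \<sigma>I[of "m - 1"] by auto
  let ?\<tau> = "insert_node \<sigma> l s"
  have strict: "strict_mono_on {0..m} ?\<tau>"
  proof (rule strict_mono_onI)
    fix a b assume ab: "a \<in> {0..m}" "b \<in> {0..m}" "a < b"
    consider "b < l" | "b = l" | "a < l" "l < b" | "a = l" | "l < a" using ab(3) by linarith
    then show "?\<tau> a < ?\<tau> b"
    proof cases
      case 1 then show ?thesis using ab strict_mono_onD[OF \<sigma>, of a b] l_less by (auto simp: insert_node_def)
    next
      case 2 then show ?thesis using ab below by (auto simp: insert_node_def)
    next
      case 3
      then have "\<sigma> a < s" "s < \<sigma> (b - 1)" using below above[of "b - 1"] ab by auto
      then show ?thesis using 3 by (auto simp: insert_node_def)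
    next
      case 4
      then have "s < \<sigma> (b - 1)" using above[of "b - 1"] ab by auto
      then show ?thesis using 4 ab by (auto simp: insert_node_def)
    next
      case 5
      then show ?thesis using ab strict_mono_onD[OF \<sigma>, of "a - 1" "b - 1"] by (auto simp: insert_node_def)
    qed
  qed
  have in_N: "?\<tau> n \<in> N" if "n \<le> m" "n \<noteq> l" for n
    using that l_less N(1) by (auto simp: insert_node_def)
  have image: "?\<tau> ` {0..m} = insert s N"
  proof
    show "?\<tau> ` {0..m} \<subseteq> insert s N"
    proof
      fix v assume "v \<in> ?\<tau> ` {0..m}"
      then obtain n where "n \<le> m" "v = ?\<tau> n" by auto
      then show "v \<in> insert s N" using in_N by (cases "n = l") (auto simp: insert_node_def)
    qed
    show "insert s N \<subseteq> ?\<tau> ` {0..m}"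
    proof
      fix v assume "v \<in> insert s N"
      then consider "v = s" | n where "n < m" "v = \<sigma> n" using N(1) by auto
      then show "v \<in> ?\<tau> ` {0..m}"
      proof cases
        case 1 then show ?thesis using l_less by (intro image_eqI[of _ _ l]) (auto simp: insert_node_def)
      next
        case 2 then show ?thesis
          by (intro image_eqI[of _ _ "if n < l then n else Suc n"]) (auto simp: insert_node_def)
      qed
    qed
  qed
  have \<tau>0: "?\<tau> 0 = 0" and \<tau>m: "?\<tau> m = 1" and \<tau>l: "?\<tau> l = s"
    using l_pos l_less \<sigma>0 \<sigma>m by (auto simp: insert_node_def)
  have inj\<tau>: "inj_on ?\<tau> {0..m}" using strict by (rule strict_mono_on_imp_inj_on)
  have out: "?\<tau> n \<notin> nbhds k t \<rho> \<longleftrightarrow> n \<in> {0, l, m}" if n: "n \<in> {0..m}" for n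
  proof
    assume "n \<in> {0, l, m}"
    then show "?\<tau> n \<notin> nbhds k t \<rho>" using \<tau>0 \<tau>m \<tau>l ends s(2) by auto
  next
    assume notin: "?\<tau> n \<notin> nbhds k t \<rho>"
    show "n \<in> {0, l, m}"
    proof (rule ccontr)
      assume "n \<notin> {0, l, m}"
      then have "?\<tau> n \<in> N" "?\<tau> n \<noteq> 0" "?\<tau> n \<noteq> 1"
        using in_N[of n] n inj_onD[OF inj\<tau>, of n 0] inj_onD[OF inj\<tau>, of n m] \<tau>0 \<tau>m by auto
      then show False using nbhds notin by auto
    qed
  qed
  have even': "even (card {n \<in> {0..m}. ?\<tau> n \<in> nbhd t \<rho> i})" if i: "i \<in> {1..k}" for i
  proof -
    have "card {n \<in> {0..m}. ?\<tau> n \<in> nbhd t \<rho> i} = card (?\<tau> ` {n \<in> {0..m}. ?\<tau> n \<in> nbhd t \<rho> i})"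
      by (rule card_image[symmetric], rule inj_on_subset[OF inj\<tau>]) auto
    also have "?\<tau> ` {n \<in> {0..m}. ?\<tau> n \<in> nbhd t \<rho> i} = insert s N \<inter> nbhd t \<rho> i"
      unfolding image[symmetric] by auto
    also have "\<dots> = N \<inter> nbhd t \<rho> i" using s(2) i by (auto simp: nbhds_def)
    finally show ?thesis using even[OF i] by simp
  qed
  show ?thesis
    unfolding card_l admissible_def
    using strict image N(2) s(1) \<tau>0 \<tau>m \<tau>l l_less out even' by auto
qed

end

section \<open>Minors and interpolation\<close>

text \<open>
  The rows belong to the \<open>m\<close> nodes; the columns are \<open>\<psi> 0, \<dots>, \<psi> m\<close> without \<open>\<psi> j\<close>.
\<close>

definition node_minor :: "nat \<Rightarrow> (nat \<Rightarrow> real \<Rightarrow> real) \<Rightarrow> (nat \<Rightarrow> real) \<Rightarrow> nat \<Rightarrow> real" where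
  "node_minor m \<psi> \<sigma> j = Determinant.det (Matrix.mat m m (\<lambda>(n, i). \<psi> (insert_index j i) (\<sigma> n)))"

text \<open>
  The minors along the inserted row depend neither on the inserted point nor on its position.
\<close>

lemma mat_delete_node_mat:
  assumes "l \<le> m" "j \<le> m"
  shows "mat_delete (node_mat m \<psi> (insert_node \<sigma> l s)) l j
    = Matrix.mat m m (\<lambda>(n, i). \<psi> (insert_index j i) (\<sigma> n))"
proof (rule eq_matI)
  fix n i assume "n < dim_row (Matrix.mat m m (\<lambda>(n, i). \<psi> (insert_index j i) (\<sigma> n)))"
    "i < dim_col (Matrix.mat m m (\<lambda>(n, i). \<psi> (insert_index j i) (\<sigma> n)))"
  then have ni: "n < m" "i < m" by simp_all
  have A: "node_mat m \<psi> (insert_node \<sigma> l s) \<in> carrier_mat (Suc m) (Suc m)" by (simp add: node_mat_def)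
  have "insert_index l n < Suc m" "insert_index j i < Suc m" using ni by (auto simp: insert_index_def)
  moreover have "insert_node \<sigma> l s (insert_index l n) = \<sigma> n"
    by (auto simp: insert_node_def insert_index_def)
  ultimately have "node_mat m \<psi> (insert_node \<sigma> l s) $$ (insert_index l n, insert_index j i) = \<psi> (insert_index j i) (\<sigma> n)"
    by (simp add: node_mat_def)
  then show "mat_delete (node_mat m \<psi> (insert_node \<sigma> l s)) l j $$ (n, i)
    = Matrix.mat m m (\<lambda>(n, i). \<psi> (insert_index j i) (\<sigma> n)) $$ (n, i)"
    using ni mat_delete_index[OF A, of l j n i] assms by simp
qed (simp_all add: node_mat_def)

text \<open>
  Laplace expansion along the inserted row, whose position enters only through the sign.
\<close>

lemma det_node_mat_insert:
  assumes "l \<le> m"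
  shows "Determinant.det (node_mat m \<psi> (insert_node \<sigma> l s))
    = (-1) ^ l * (\<Sum>j\<le>m. (-1) ^ j * node_minor m \<psi> \<sigma> j * \<psi> j s)"
proof -
  let ?A = "node_mat m \<psi> (insert_node \<sigma> l s)"
  have A: "?A \<in> carrier_mat (Suc m) (Suc m)" by (simp add: node_mat_def)
  have "Determinant.det ?A = (\<Sum>j<Suc m. ?A $$ (l, j) * cofactor ?A l j)"
    by (rule laplace_expansion_row[OF A]) (use assms in simp)
  also have "\<dots> = (\<Sum>j<Suc m. (-1) ^ l * ((-1) ^ j * node_minor m \<psi> \<sigma> j * \<psi> j s))"
  proof (rule sum.cong[OF refl])
    fix j assume j: "j \<in> {..<Suc m}"
    have "?A $$ (l, j) = \<psi> j s" using j assms by (simp add: node_mat_def insert_node_def)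
    moreover have "cofactor ?A l j = (-1) ^ (l + j) * node_minor m \<psi> \<sigma> j"
      unfolding cofactor_def node_minor_def using j assms by (subst mat_delete_node_mat) auto
    ultimately show "?A $$ (l, j) * cofactor ?A l j
        = (-1) ^ l * ((-1) ^ j * node_minor m \<psi> \<sigma> j * \<psi> j s)"
      by (simp add: power_add)
  qed
  finally show ?thesis by (simp only: sum_distrib_left lessThan_Suc_atMost)
qed

text \<open>
  The expansion is a determinant with two equal rows.
\<close>

lemma minor_expansion_at_node:
  assumes "n < m"
  shows "(\<Sum>j\<le>m. (-1) ^ j * node_minor m \<psi> \<sigma> j * \<psi> j (\<sigma> n)) = 0"
proof -
  let ?A = "node_mat m \<psi> (insert_node \<sigma> 0 (\<sigma> n))"
  have A: "?A \<in> carrier_mat (Suc m) (Suc m)" by (simp add: node_mat_def)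
  have "Matrix.row ?A 0 = Matrix.row ?A (Suc n)"
    using assms by (intro eq_vecI) (auto simp: node_mat_def insert_node_def)
  then have "Determinant.det ?A = 0"
    using det_identical_rows[OF A, of 0 "Suc n"] assms by simp
  then show ?thesis unfolding det_node_mat_insert[OF le0] by simp
qed

text \<open>
  Cramer's rule for the polynomial in \<open>\<psi> 1, \<dots>, \<psi> m\<close> that interpolates \<open>\<psi> 0\<close> at the nodes.
\<close>

definition interp_coeffs :: "nat \<Rightarrow> (nat \<Rightarrow> real \<Rightarrow> real) \<Rightarrow> (nat \<Rightarrow> real) \<Rightarrow> nat \<Rightarrow> real" where
  "interp_coeffs m \<psi> \<sigma> j = - ((-1) ^ j * node_minor m \<psi> \<sigma> j / node_minor m \<psi> \<sigma> 0)"

lemma minor_expansion_interp: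
  assumes "node_minor m \<psi> \<sigma> 0 \<noteq> 0"
  shows "(\<Sum>j\<le>m. (-1) ^ j * node_minor m \<psi> \<sigma> j * \<psi> j s)
    = node_minor m \<psi> \<sigma> 0 * (\<psi> 0 s - gpoly m \<psi> (interp_coeffs m \<psi> \<sigma>) s)"
proof -
  have "{..m} = insert 0 {1..m}" by auto
  then have "(\<Sum>j\<le>m. (-1) ^ j * node_minor m \<psi> \<sigma> j * \<psi> j s)
     = node_minor m \<psi> \<sigma> 0 * \<psi> 0 s + (\<Sum>j\<in>{1..m}. (-1) ^ j * node_minor m \<psi> \<sigma> j * \<psi> j s)" by simp
  also have "(\<Sum>j\<in>{1..m}. (-1) ^ j * node_minor m \<psi> \<sigma> j * \<psi> j s)
     = (\<Sum>j\<in>{1..m}. - (node_minor m \<psi> \<sigma> 0 * (interp_coeffs m \<psi> \<sigma> j * \<psi> j s)))"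
    using assms by (intro sum.cong refl) (simp add: interp_coeffs_def)
  also have "\<dots> = - (node_minor m \<psi> \<sigma> 0 * gpoly m \<psi> (interp_coeffs m \<psi> \<sigma>) s)"
    by (simp add: sum_negf sum_distrib_left)
  finally show ?thesis by (simp add: right_diff_distrib)
qed

lemma node_minor_0: "node_minor m (\<phi>(0 := G)) \<sigma> 0
  = Determinant.det (Matrix.mat m m (\<lambda>(n, i). \<phi> (Suc i) (\<sigma> n)))"
  by (simp add: node_minor_def)

lemma gpoly_fun_upd_0: "gpoly m (\<phi>(0 := G)) b s = gpoly m \<phi> b s"
  by (intro sum.cong) auto

section \<open>Interpolants with merging nodes\<close>

lemma eventually_not_in_nbhds:
  assumes "s \<notin> t ` {1..k}"
  shows "\<forall>\<^sub>F \<rho> in at_right 0. s \<notin> nbhds k t \<rho>"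
proof -
  have "\<forall>\<^sub>F \<rho> in at_right 0. \<forall>i\<in>{1..k}. \<rho> < \<bar>s - t i\<bar>"
  proof (rule eventually_ball_finite, simp, rule ballI)
    fix i assume "i \<in> {1..k}"
    then have "0 < \<bar>s - t i\<bar>" using assms by auto
    then show "\<forall>\<^sub>F \<rho> in at_right 0. \<rho> < \<bar>s - t i\<bar>"
      by (intro eventually_at_rightI[of 0 "\<bar>s - t i\<bar>"]) auto
  qed
  then show ?thesis
    by eventually_elim (fastforce simp: nbhds_def nbhd_def)
qed

context separated_support
begin

definition base_nodes :: "nat \<Rightarrow> real \<Rightarrow> nat \<Rightarrow> real" where
  "base_nodes m \<rho> = (SOME \<sigma>. bij_betw \<sigma> {..<m} (node_set k t m \<rho>) \<and> strict_mono_on {..<m} \<sigma>)"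

lemma base_nodes_props:
  assumes k: "1 \<le> k" and m: "2 * k + 2 \<le> m" "even m" and \<rho>: "0 < \<rho>" "\<rho> < \<epsilon>"
  shows "base_nodes m \<rho> ` {..<m} = node_set k t m \<rho>" "strict_mono_on {..<m} (base_nodes m \<rho>)"
    "\<And>s. s \<in> {0<..<1} \<Longrightarrow> s \<notin> nbhds k t \<rho> \<Longrightarrow>
       \<exists>l. odd l \<and> admissible k t m \<rho> (insert_node (base_nodes m \<rho>) l s) l"
    "\<And>s. 0 < s \<Longrightarrow> s < \<epsilon> \<Longrightarrow> admissible k t m \<rho> (insert_node (base_nodes m \<rho>) 1 s) 1"
proof -
  note N = node_set_props[OF assms]
  have "\<exists>\<sigma>. bij_betw \<sigma> {..<m} (node_set k t m \<rho>) \<and> strict_mono_on {..<m} \<sigma>"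
    using ex_increasing_enumeration[OF N(1)] N(2) by metis
  from someI_ex[OF this]
  have b: "bij_betw (base_nodes m \<rho>) {..<m} (node_set k t m \<rho>)"
    and mono: "strict_mono_on {..<m} (base_nodes m \<rho>)"
    by (simp_all add: base_nodes_def)
  show im: "base_nodes m \<rho> ` {..<m} = node_set k t m \<rho>" using b by (rule bij_betw_imp_surj_on)
  show "strict_mono_on {..<m} (base_nodes m \<rho>)" by fact
  have ends: "{0, 1} \<subseteq> node_set k t m \<rho>" by (auto simp: node_set_def)
  note adm = admissible_insert_node[OF mono im N(3) ends N(4) \<rho>(2) N(6)]
  show "\<exists>l. odd l \<and> admissible k t m \<rho> (insert_node (base_nodes m \<rho>) l s) l"
    if "s \<in> {0<..<1}" "s \<notin> nbhds k t \<rho>" for s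
    using adm[OF _ that] N(7)[OF that] by blast
  show "admissible k t m \<rho> (insert_node (base_nodes m \<rho>) 1 s) 1" if s: "0 < s" "s < \<epsilon>" for s
  proof -
    have "s \<in> {0<..<1}" "s \<notin> nbhds k t \<rho>"
      using s \<epsilon>_half not_in_nbhds_near_ends[of \<rho> s] \<rho> by auto
    from adm[OF _ this] N(8)[OF s] show ?thesis by simp
  qed
qed

text \<open>
  Positivity of the determinants says that the interpolants lie on one side of \<open>G\<close> off the
  neighbourhoods, above or below according to the sign \<open>sg\<close> of their common denominator.  The rate
  condition bounds their coefficients, and interpolation and one-sidedness survive in the limit.
\<close>

lemma T_star_limit_gpoly:
  fixes G :: "real \<Rightarrow> real"
  assumes k: "1 \<le> k" and m: "2 * k + 2 \<le> m"
    and T: "T_system m \<phi>" and T_star: "T_star_system k t m (\<phi>(0 := G))"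
    and \<rho>: "\<And>n. 0 < \<rho> n" "\<And>n. \<rho> n < \<epsilon>" "\<rho> \<longlonglongrightarrow> 0"
    and sgn: "\<And>n. 0 < sg * node_minor m (\<phi>(0 := G)) (base_nodes m (\<rho> n)) 0"
  shows "\<exists>b. (\<forall>s\<in>{0, 1} \<union> t ` {1..k}. gpoly m \<phi> b s = G s)
    \<and> (\<forall>s\<in>unit_I. sg * G s \<le> sg * gpoly m \<phi> b s)"
proof -
  let ?\<psi> = "\<phi>(0 := G)"
  have even: "even m" using T_star by (simp add: T_star_system_def)
  note base = base_nodes_props[OF k m even]
  define M where "M \<rho> j = node_minor m ?\<psi> (base_nodes m \<rho>) j" for \<rho> j
  define B where "B n = interp_coeffs m ?\<psi> (base_nodes m (\<rho> n))" for n
  have M0: "M (\<rho> n) 0 \<noteq> 0" for n using sgn[of n] by (auto simp: M_def)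
  have sg: "sg \<noteq> 0" using sgn[of 0] by auto
  have lim\<rho>: "filterlim \<rho> (at_right 0) sequentially"
    unfolding filterlim_at using \<rho> by (auto simp: less_imp_neq[symmetric])
  \<comment> \<open>All minors have the rate of the zeroth one, hence the quotients \<open>interp_coeffs\<close> stay bounded;
    the node near the left end point serves only to read off the minors.\<close>
  have bigo: "(\<lambda>\<rho>. \<bar>M \<rho> j\<bar>) \<in> O[at_right 0](\<lambda>\<rho>. \<bar>M \<rho> 0\<bar>)" if j: "j \<in> {0..m}" for j
  proof -
    have adm: "\<forall>\<^sub>F \<rho> in at_right 0. admissible k t m \<rho> (insert_node (base_nodes m \<rho>) 1 (\<epsilon> / 2)) 1"
      using base(4) \<epsilon>_pos by (intro eventually_at_rightI[of 0 \<epsilon>]) auto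
    have del: "Determinant.det (mat_delete (node_mat m ?\<psi> (insert_node (base_nodes m \<rho>) 1 (\<epsilon> / 2))) 1 j) = M \<rho> j"
      if "j \<in> {0..m}" for \<rho> j
      unfolding M_def node_minor_def using that m by (subst mat_delete_node_mat) auto
    have "\<forall>\<tau> l. (\<forall>\<^sub>F \<rho> in at_right 0. admissible k t m \<rho> (\<tau> \<rho>) l) \<longrightarrow>
        (\<exists>r :: real \<Rightarrow> real. (r \<longlongrightarrow> 0) (at_right 0) \<and>
           (\<forall>j\<in>{0..m}. (\<lambda>\<rho>. \<bar>Determinant.det (mat_delete (node_mat m ?\<psi> (\<tau> \<rho>)) l j)\<bar>)
                           \<in> \<Theta>[at_right 0](r)))"
      using T_star unfolding T_star_system_def by (elim conjE)
    from mp[OF spec[OF spec[OF this, of "\<lambda>\<rho>. insert_node (base_nodes m \<rho>) 1 (\<epsilon> / 2)"], of 1] adm]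
    obtain r :: "real \<Rightarrow> real" where r: "\<forall>j\<in>{0..m}. (\<lambda>\<rho>. \<bar>Determinant.det
        (mat_delete (node_mat m ?\<psi> (insert_node (base_nodes m \<rho>) 1 (\<epsilon> / 2))) 1 j)\<bar>) \<in> \<Theta>[at_right 0](r)"
      by (elim exE conjE) (rule that)
    have r: "(\<lambda>\<rho>. \<bar>M \<rho> j\<bar>) \<in> \<Theta>[at_right 0](r)" if "j \<in> {0..m}" for j
      using bspec[OF r that] unfolding del[OF that] .
    have "(\<lambda>\<rho>. \<bar>M \<rho> j\<bar>) \<in> O[at_right 0](r)" using r j by (intro bigthetaD1) auto
    moreover have "r \<in> O[at_right 0](\<lambda>\<rho>. \<bar>M \<rho> 0\<bar>)"
      using r[of 0] by (simp add: bigtheta_sym[of r] bigthetaD1)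
    ultimately show ?thesis by (rule landau_o.big_trans)
  qed
  have "\<exists>C. \<forall>\<^sub>F n in sequentially. \<forall>j\<in>{1..m}. \<bar>B n j\<bar> \<le> C"
  proof -
    have "\<forall>j\<in>{1..m}. \<exists>c. \<forall>\<^sub>F n in sequentially. \<bar>B n j\<bar> \<le> c"
    proof
      fix j assume j: "j \<in> {1..m}"
      then obtain c where "\<forall>\<^sub>F \<rho> in at_right 0. norm \<bar>M \<rho> j\<bar> \<le> c * norm \<bar>M \<rho> 0\<bar>"
        using bigo[of j] by (auto elim: landau_o.bigE)
      then have "\<forall>\<^sub>F n in sequentially. norm \<bar>M (\<rho> n) j\<bar> \<le> c * norm \<bar>M (\<rho> n) 0\<bar>"
        by (rule eventually_compose_filterlim[OF _ lim\<rho>])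
      then have "\<forall>\<^sub>F n in sequentially. \<bar>B n j\<bar> \<le> c"
      proof eventually_elim
        case (elim n)
        then show ?case using M0[of n]
          by (simp add: B_def interp_coeffs_def M_def abs_mult power_abs divide_le_eq)
      qed
      then show "\<exists>c. \<forall>\<^sub>F n in sequentially. \<bar>B n j\<bar> \<le> c" by blast
    qed
    then obtain c where c: "\<forall>j\<in>{1..m}. \<forall>\<^sub>F n in sequentially. \<bar>B n j\<bar> \<le> c j"
      by (rule bchoice[THEN exE])
    have "\<forall>\<^sub>F n in sequentially. \<forall>j\<in>{1..m}. \<bar>B n j\<bar> \<le> c j"
      using c by (intro eventually_ball_finite) auto
    then have "\<forall>\<^sub>F n in sequentially. \<forall>j\<in>{1..m}. \<bar>B n j\<bar> \<le> Max (c ` {1..m})"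
      by eventually_elim (auto intro: order_trans[OF _ Max_ge])
    then show ?thesis by blast
  qed
  then obtain C n0 where C: "\<And>n j. n \<ge> n0 \<Longrightarrow> j \<in> {1..m} \<Longrightarrow> \<bar>B n j\<bar> \<le> C"
    unfolding eventually_sequentially by blast
  obtain b and r :: "nat \<Rightarrow> nat" where r: "strict_mono r"
    and lim: "\<forall>\<phi> s. (\<lambda>n. gpoly m \<phi> (B (r n + n0)) s) \<longlonglongrightarrow> gpoly m \<phi> b s"
    by (rule bounded_coeffs_convergent_subsequence[of m "\<lambda>n. B (n + n0)" C, OF C])
      (simp, assumption, (rule that; assumption))
  have sub: "filterlim (\<lambda>n. r n + n0) sequentially sequentially"
    using filterlim_subseq[OF r] by (intro filterlim_compose[OF filterlim_add_const_nat_at_top])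
  have lim': "(\<lambda>n. gpoly m \<phi> (B (r n + n0)) s) \<longlonglongrightarrow> gpoly m \<phi> b s" for s
    using lim by blast
  have M0\<psi>: "node_minor m ?\<psi> (base_nodes m (\<rho> n)) 0 \<noteq> 0" for n using M0 by (simp add: M_def)
  have interp: "gpoly m \<phi> (B n) s = G s" if "s \<in> {0, 1} \<union> t ` {1..k}" for n s
  proof -
    have "s \<in> node_set k t m (\<rho> n)"
      using that node_set_props(5)[OF k m even \<rho>(1,2)] by (auto simp: node_set_def)
    then obtain i where i: "i < m" "s = base_nodes m (\<rho> n) i"
      using base(1)[OF \<rho>(1,2), of n] by (metis imageE lessThan_iff)
    have "M (\<rho> n) 0 * (G s - gpoly m \<phi> (B n) s) = 0"
      using minor_expansion_at_node[OF i(1), of ?\<psi> "base_nodes m (\<rho> n)"]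
        minor_expansion_interp[OF M0\<psi>, of n s] i(2)
      by (simp add: M_def B_def gpoly_fun_upd_0 del: fun_upd_apply) (simp add: gpoly_fun_upd_0)
    then show ?thesis using M0 by simp
  qed
  have eq: "gpoly m \<phi> b s = G s" if "s \<in> {0, 1} \<union> t ` {1..k}" for s
    using LIMSEQ_unique[OF lim'[of s]] interp[OF that] by simp
  have "sg * G s \<le> sg * gpoly m \<phi> b s" if s: "s \<in> unit_I" for s
  proof (cases "s \<in> {0, 1} \<union> t ` {1..k}")
    case False
    have pos: "\<forall>\<^sub>F \<rho> in at_right 0. \<forall>\<tau> l. admissible k t m \<rho> \<tau> l \<longrightarrow>
        Determinant.det (node_mat m ?\<psi> \<tau>) > 0"
      using T_star by (simp add: T_star_system_def)
    have ev: "\<forall>\<^sub>F \<rho> in at_right 0. s \<notin> nbhds k t \<rho>"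
      by (rule eventually_not_in_nbhds) (use False in simp)
    have "\<forall>\<^sub>F n in sequentially. s \<notin> nbhds k t (\<rho> n) \<and>
        (\<forall>\<tau> l. admissible k t m (\<rho> n) \<tau> l \<longrightarrow> Determinant.det (node_mat m ?\<psi> \<tau>) > 0)"
      using eventually_compose_filterlim[OF eventually_conj[OF ev pos] lim\<rho>] .
    then have "\<forall>\<^sub>F n in sequentially. sg * G s \<le> sg * gpoly m \<phi> (B n) s"
    proof eventually_elim
      case (elim n)
      have "s \<in> {0<..<1}" using s False by auto
      then obtain l where l: "odd l" "admissible k t m (\<rho> n) (insert_node (base_nodes m (\<rho> n)) l s) l"
        using base(3)[OF \<rho>(1,2), of s n] elim by blast
      then have "0 < Determinant.det (node_mat m ?\<psi> (insert_node (base_nodes m (\<rho> n)) l s))"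
        using elim by blast
      also have "\<dots> = - (\<Sum>j\<le>m. (-1) ^ j * node_minor m ?\<psi> (base_nodes m (\<rho> n)) j * ?\<psi> j s)"
        using l by (subst det_node_mat_insert) (auto simp: admissible_def)
      also have "\<dots> = M (\<rho> n) 0 * (gpoly m \<phi> (B n) s - G s)"
        unfolding minor_expansion_interp[OF M0\<psi>]
        by (simp add: M_def B_def gpoly_fun_upd_0 right_diff_distrib)
      finally have "0 < M (\<rho> n) 0 * (gpoly m \<phi> (B n) s - G s)" .
      moreover have "0 < sg * M (\<rho> n) 0" using sgn by (simp add: M_def)
      ultimately have "0 < sg * (gpoly m \<phi> (B n) s - G s)"
        by (auto simp: zero_less_mult_iff)
      then show ?case by (simp add: right_diff_distrib)
    qed
    then have "\<forall>\<^sub>F n in sequentially. sg * G s \<le> sg * gpoly m \<phi> (B (r n + n0)) s"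
      by (rule eventually_compose_filterlim[OF _ sub])
    moreover have "(\<lambda>n. sg * gpoly m \<phi> (B (r n + n0)) s) \<longlonglongrightarrow> sg * gpoly m \<phi> b s"
      by (intro tendsto_mult_left lim')
    ultimately show ?thesis by (intro tendsto_lowerbound[of _ _ sequentially]) auto
  qed (use eq in simp)
  with eq show ?thesis by blast
qed

end

section \<open>Existence of the dual polynomials\<close>

text \<open>
  Selects radii along which the T-system determinant of the nodes keeps one sign.
\<close>

lemma constant_sign_sequence:
  fixes D :: "real \<Rightarrow> real"
  assumes "0 < \<epsilon>" and nz: "\<And>\<rho>. 0 < \<rho> \<Longrightarrow> \<rho> < \<epsilon> \<Longrightarrow> D \<rho> \<noteq> 0"
  obtains sg :: real and \<rho> :: "nat \<Rightarrow> real" where "sg = 1 \<or> sg = - 1" "\<forall>n. 0 < \<rho> n" "\<forall>n. \<rho> n < \<epsilon>"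
    "\<rho> \<longlonglongrightarrow> 0" "\<forall>n. 0 < sg * D (\<rho> n)"
proof -
  define a where "a n = \<epsilon> / real (n + 2)" for n
  have a: "0 < a n" "a n < \<epsilon>" for n using assms(1) by (simp_all add: a_def divide_less_eq)
  have "(\<lambda>n. \<epsilon> * inverse (real (Suc (Suc n)))) \<longlonglongrightarrow> \<epsilon> * 0"
    by (intro tendsto_mult_left LIMSEQ_Suc[OF LIMSEQ_inverse_real_of_nat])
  then have a0: "a \<longlonglongrightarrow> 0" by (simp add: a_def[abs_def] divide_inverse)
  have "\<exists>sg. (sg = 1 \<or> sg = - 1) \<and> (\<forall>N. \<exists>n\<ge>N. 0 < sg * D (a n))"
  proof (cases "\<forall>N. \<exists>n\<ge>N. 0 < D (a n)")
    case True
    then show ?thesis by (intro exI[of _ 1]) simp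
  next
    case False
    then obtain N where "\<And>n. n \<ge> N \<Longrightarrow> \<not> 0 < D (a n)" by blast
    then have "D (a n) < 0" if "n \<ge> N" for n using nz[OF a, of n] that by (meson linorder_neqE)
    then have "0 < - 1 * D (a (max N M))" for M by simp
    then show ?thesis by (intro exI[of _ "- 1"]) (metis max.cobounded2)
  qed
  then obtain sg where sg: "sg = 1 \<or> sg = - 1" "\<forall>N. \<exists>n\<ge>N. 0 < sg * D (a n)" by blast
  then obtain g where g: "\<And>N. g N \<ge> N" "\<And>N. 0 < sg * D (a (g N))" by metis
  have "filterlim g at_top sequentially"
    using g(1) by (intro filterlim_at_top_mono[OF filterlim_ident]) auto
  then have "(\<lambda>n. a (g n)) \<longlonglongrightarrow> 0" by (rule filterlim_compose[OF a0])
  then show ?thesis using that[of sg "\<lambda>n. a (g n)"] sg(1) a g(2) by blast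
qed

lemma continuous_le_at_0:
  fixes q :: "real \<Rightarrow> real"
  assumes "continuous_on unit_I q" "0 < d" "d \<le> 1" "\<And>s. 0 < s \<Longrightarrow> s < d \<Longrightarrow> q s \<le> c"
  shows "q 0 \<le> c"
proof -
  have cl: "closure {0<..<d} = {0..d}" using assms(2) by simp
  have "continuous_on (closure {0<..<d}) q"
    unfolding cl by (rule continuous_on_subset[OF assms(1)]) (use assms(3) in auto)
  from continuous_le_on_closure[OF this, of 0 c] show ?thesis
    unfolding cl using assms(2,4) by auto
qed

lemma continuous_ge_at_0:
  fixes q :: "real \<Rightarrow> real"
  assumes "continuous_on unit_I q" "0 < d" "d \<le> 1" "\<And>s. 0 < s \<Longrightarrow> s < d \<Longrightarrow> c \<le> q s"
  shows "c \<le> q 0"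
  using continuous_le_at_0[of "\<lambda>s. - q s" d "- c"] assms by (auto intro: continuous_on_minus)

lemma continuous_ge_at_1:
  fixes q :: "real \<Rightarrow> real"
  assumes "continuous_on unit_I q" "0 < d" "d \<le> 1" "\<And>s. 1 - d < s \<Longrightarrow> s < 1 \<Longrightarrow> c \<le> q s"
  shows "c \<le> q 1"
proof -
  have "continuous_on unit_I (\<lambda>s. q (1 - s))"
    by (rule continuous_on_compose2[OF assms(1)]) (auto intro!: continuous_intros)
  from continuous_ge_at_0[OF this assms(2,3), of c] show ?thesis using assms(4) by simp
qed

locale dual_separators = separated_support k t \<epsilon>
  for k :: nat and t :: "nat \<Rightarrow> real" and \<epsilon> :: real +
  fixes m :: nat and \<phi> :: "nat \<Rightarrow> real \<Rightarrow> real" and f :: "real \<Rightarrow> real" and fbar f0 f1 :: real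
  assumes T: "T_system m \<phi>" and m: "2 * k + 2 \<le> m"
    and f: "\<And>s. 0 \<le> f s" "f 0 = 0" and f_consts: "0 < fbar" "0 < f0" "0 < f1"
begin

abbreviation F :: "real \<Rightarrow> real" where "F \<equiv> sep_F k t \<epsilon> f fbar f0 f1"
abbreviation F_sign :: "(nat \<Rightarrow> real) \<Rightarrow> real \<Rightarrow> real" where "F_sign \<equiv> sep_F_sign k t \<epsilon> f fbar f0 f1"

lemma F_nonneg: "0 \<le> F s"
  using f f_consts by (simp add: sep_F_def)

lemma continuous_gpoly: "continuous_on unit_I (gpoly m \<phi> b)"
  using T by (intro continuous_on_gpoly) (auto simp: T_system_def)

lemma F_off_nbhds: "s \<in> {0<..<1} \<Longrightarrow> s \<notin> nbhds k t \<epsilon> \<Longrightarrow> F s = fbar"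
  "s \<in> {0<..<1} \<Longrightarrow> s \<notin> nbhds k t \<epsilon> \<Longrightarrow> F_sign \<pi> s = - fbar"
  by (auto simp: sep_F_def sep_F_sign_def)

lemma F_at_t:
  assumes "i \<in> {1..k}"
  shows "F (t i) = 0" "F_sign \<pi> (t i) = \<pi> i"
proof -
  have "t i \<in> {0<..<1}" by (rule subsetD[OF interior imageI[OF assms]])
  moreover have "t i \<in> nbhds k t \<epsilon>"
    by (rule in_nbhdsI[OF assms t_in_nbhd[OF assms]]) (use \<epsilon>_pos in simp)
  ultimately show "F (t i) = 0" "F_sign \<pi> (t i) = \<pi> i"
    using nbhd_index_t[OF assms] f(2) by (auto simp: sep_F_def sep_F_sign_def)
qed

text \<open>
  The terms \<open>f\<close> and \<open>fbar\<close> cancel in the sum.  Since \<open>f\<close> may fail to be measurable, cancelling it before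
  integrating is what makes the estimates possible.
\<close>

lemma F_add_F_sign:
  assumes "s \<in> unit_I"
  shows "(if s \<in> nbhds k t \<epsilon> then \<pi> (nbhd_index k t \<epsilon> s) else 0) \<le> F s + F_sign \<pi> s"
proof -
  have "0 \<notin> nbhds k t \<epsilon>" "1 \<notin> nbhds k t \<epsilon>" using not_in_nbhds_near_ends[of \<epsilon>] \<epsilon>_pos by auto
  then show ?thesis using f_consts by (auto simp: sep_F_def sep_F_sign_def)
qed

text \<open>
  At the end points \<open>F\<close> may be smaller than \<open>fbar\<close>; there the estimate comes from the neighbouring points by
  continuity.
\<close>

lemma gpoly_ge_fbar:
  assumes ge: "\<And>s. s \<in> unit_I \<Longrightarrow> F s \<le> gpoly m \<phi> b s" and s: "s \<in> unit_I" "s \<notin> nbhds k t \<epsilon>"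
  shows "fbar \<le> gpoly m \<phi> b s"
proof -
  consider "s = 0" | "s = 1" | "s \<in> {0<..<1}" using s(1) by fastforce
  then show ?thesis
  proof cases
    case 1
    have "fbar \<le> gpoly m \<phi> b u" if "0 < u" "u < \<epsilon>" for u
      using ge[of u] F_off_nbhds(1)[of u] not_in_nbhds_near_ends[of \<epsilon> u] that \<epsilon>_half by auto
    then show ?thesis unfolding 1
      using continuous_ge_at_0[OF continuous_gpoly \<epsilon>_pos] \<epsilon>_half by auto
  next
    case 2
    have "fbar \<le> gpoly m \<phi> b u" if "1 - \<epsilon> < u" "u < 1" for u
      using ge[of u] F_off_nbhds(1)[of u] not_in_nbhds_near_ends[of \<epsilon> u] that \<epsilon>_half by auto
    then show ?thesis unfolding 2
      using continuous_ge_at_1[OF continuous_gpoly \<epsilon>_pos] \<epsilon>_half by auto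
  next
    case 3
    then show ?thesis using ge[OF s(1)] F_off_nbhds(1)[OF 3 s(2)] by simp
  qed
qed

text \<open>
  The same nodes, and hence the same sequence of radii, serve for \<open>F\<close> and for all \<open>F_sign \<pi>\<close>, because the
  determinant deciding the sign does not involve the zeroth function.
\<close>

lemma dual_polynomials_exist:
  assumes T_star: "T_star_system k t m (\<phi>(0 := F))"
    and T_star_sign: "\<And>\<pi>. \<pi> \<in> sign_patterns k \<Longrightarrow> T_star_system k t m (\<phi>(0 := F_sign \<pi>))"
  shows "(\<exists>b. (\<forall>s\<in>t ` {1..k}. gpoly m \<phi> b s = F s) \<and> (\<forall>s\<in>unit_I. F s \<le> gpoly m \<phi> b s)) \<and>
    (\<forall>\<pi>\<in>sign_patterns k. \<exists>b. (\<forall>s\<in>t ` {1..k}. gpoly m \<phi> b s = F_sign \<pi> s)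
      \<and> (\<forall>s\<in>unit_I. F_sign \<pi> s \<le> gpoly m \<phi> b s))"
proof (cases "k = 0")
  case True
  define C where "C = max fbar (max f0 f1)"
  have C: "0 < C" using f_consts by (simp add: C_def)
  have le: "F s \<le> C" "F_sign \<pi> s \<le> C" for s \<pi>
    using True f_consts by (auto simp: sep_F_def sep_F_sign_def nbhds_def C_def)
  have "1 \<le> m" using m by simp
  from T_system_positive_gpoly[OF T this] obtain p where p: "\<forall>s\<in>unit_I. 0 < gpoly m \<phi> p s"
    by (elim exE) (rule that)
  have "unit_I \<noteq> {}" by simp
  from continuous_attains_inf[OF compact_Icc this continuous_gpoly, of p]
  obtain s0 where s0: "s0 \<in> unit_I" "\<forall>s\<in>unit_I. gpoly m \<phi> p s0 \<le> gpoly m \<phi> p s"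
    by (elim bexE) (rule that)
  define c where "c = C / gpoly m \<phi> p s0"
  have c: "0 < c" using C bspec[OF p s0(1)] by (simp add: c_def)
  have "C \<le> gpoly m \<phi> (\<lambda>j. 0 + c * p j) s" if "s \<in> unit_I" for s
  proof -
    have "C = c * gpoly m \<phi> p s0" using bspec[OF p s0(1)] by (simp add: c_def)
    also have "\<dots> \<le> c * gpoly m \<phi> p s" using bspec[OF s0(2) that] c by simp
    finally show ?thesis by (subst gpoly_add_scaled) simp
  qed
  then have dominates: "F s \<le> gpoly m \<phi> (\<lambda>j. 0 + c * p j) s" "F_sign \<pi> s \<le> gpoly m \<phi> (\<lambda>j. 0 + c * p j) s"
    if "s \<in> unit_I" for s \<pi> using le that order_trans by blast+
  have noT: "s \<notin> t ` {1..k}" for s using True by simp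
  show ?thesis
    by (intro conjI ballI exI[of _ "\<lambda>j. 0 + c * p j"]) (erule dominates notE[OF noT])+
next
  case False
  then have k: "1 \<le> k" by simp
  have even: "even m" using T_star by (simp add: T_star_system_def)
  define D where "D \<rho> = Determinant.det (Matrix.mat m m (\<lambda>(n, i). \<phi> (Suc i) (base_nodes m \<rho> n)))" for \<rho>
  have minor_D: "node_minor m (\<phi>(0 := G)) (base_nodes m \<rho>) 0 = D \<rho>" for \<rho> G
    by (simp only: node_minor_0 D_def)
  have D_nonzero: "D \<rho> \<noteq> 0" if \<rho>: "0 < \<rho>" "\<rho> < \<epsilon>" for \<rho>
    unfolding D_def
  proof (rule T_system_det_nonzero[OF T])
    show "strict_mono_on {..<m} (base_nodes m \<rho>)" by (rule base_nodes_props(2)[OF k m even \<rho>])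
    show "base_nodes m \<rho> ` {..<m} \<subseteq> unit_I"
      unfolding base_nodes_props(1)[OF k m even \<rho>] by (rule node_set_props(3)[OF k m even \<rho>])
  qed
  obtain sg and \<rho> :: "nat \<Rightarrow> real" where sg: "sg = 1 \<or> sg = - 1" and \<rho>: "\<forall>n. 0 < \<rho> n" "\<forall>n. \<rho> n < \<epsilon>" "\<rho> \<longlonglongrightarrow> 0"
    and sgn: "\<forall>n. 0 < sg * D (\<rho> n)"
    by (rule constant_sign_sequence[of \<epsilon> D, OF \<epsilon>_pos D_nonzero])
      (assumption, assumption, (rule that; assumption))
  have limit: "\<exists>b. (\<forall>s\<in>{0, 1} \<union> t ` {1..k}. gpoly m \<phi> b s = G s)
    \<and> (\<forall>s\<in>unit_I. sg * G s \<le> sg * gpoly m \<phi> b s)" if "T_star_system k t m (\<phi>(0 := G))" for G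
    by (rule T_star_limit_gpoly[OF k m T that spec[OF \<rho>(1)] spec[OF \<rho>(2)] \<rho>(3)])
      (use sgn in \<open>simp only: minor_D\<close>)
  \<comment> \<open>Otherwise a continuous function equal to \<open>f0 > 0\<close> at \<open>0\<close> would be at most \<open>-fbar\<close> nearby.\<close>
  have "sg = 1"
  proof (rule ccontr)
    assume "sg \<noteq> 1"
    then have sg': "sg = - 1" using sg by simp
    define \<pi> where "\<pi> = restrict (\<lambda>_. 1 :: real) {1..k}"
    have "\<pi> \<in> sign_patterns k" by (auto simp: \<pi>_def sign_patterns_def)
    from limit[OF T_star_sign[OF this]] obtain b where
      eq: "\<forall>s\<in>{0, 1} \<union> t ` {1..k}. gpoly m \<phi> b s = F_sign \<pi> s"
      and le: "\<forall>s\<in>unit_I. sg * F_sign \<pi> s \<le> sg * gpoly m \<phi> b s"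
      by (elim exE conjE) (rule that)
    have b: "gpoly m \<phi> b 0 = F_sign \<pi> 0" "\<And>s. s \<in> unit_I \<Longrightarrow> gpoly m \<phi> b s \<le> F_sign \<pi> s"
      using bspec[OF eq, of 0] bspec[OF le] unfolding sg' by auto
    have "gpoly m \<phi> b s \<le> - fbar" if "0 < s" "s < \<epsilon>" for s
      using b(2)[of s] F_off_nbhds(2)[of s] not_in_nbhds_near_ends[of \<epsilon> s] that \<epsilon>_half by auto
    then have "gpoly m \<phi> b 0 \<le> - fbar"
      using continuous_le_at_0[OF continuous_gpoly \<epsilon>_pos] \<epsilon>_half by auto
    then show False using b(1) f_consts by (simp add: sep_F_sign_def)
  qed
  have dual: "\<exists>b. (\<forall>s\<in>t ` {1..k}. gpoly m \<phi> b s = G s) \<and> (\<forall>s\<in>unit_I. G s \<le> gpoly m \<phi> b s)"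
    if "T_star_system k t m (\<phi>(0 := G))" for G
  proof -
    from limit[OF that] obtain b where "\<forall>s\<in>{0, 1} \<union> t ` {1..k}. gpoly m \<phi> b s = G s"
      "\<forall>s\<in>unit_I. sg * G s \<le> sg * gpoly m \<phi> b s"
      by (elim exE conjE) (rule that)
    then show ?thesis unfolding \<open>sg = 1\<close> mult_1 by (intro exI[of _ b] conjI ballI) (erule bspec, simp)+
  qed
  show ?thesis using dual[OF T_star] dual[OF T_star_sign] by (intro conjI ballI)
qed

end

section \<open>Mass estimates from dual polynomials\<close>

lemma L2_set_diff_le:
  fixes u v :: "'i \<Rightarrow> real"
  shows "L2_set (\<lambda>j. u j - v j) S \<le> L2_set u S + L2_set v S"
  using L2_set_triangle_ineq[of u "\<lambda>j. - v j" S] by (simp add: L2_set_def)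

lemma sum_mult_le_L2_set:
  fixes u v :: "'i \<Rightarrow> real"
  shows "(\<Sum>j\<in>S. u j * v j) \<le> L2_set u S * L2_set v S"
proof -
  have "(\<Sum>j\<in>S. u j * v j) \<le> (\<Sum>j\<in>S. \<bar>u j\<bar> * \<bar>v j\<bar>)"
    by (intro sum_mono) (metis abs_ge_self abs_mult)
  then show ?thesis using L2_set_mult_ineq[of u v S] by linarith
qed

lemma integrable_continuous_on_I:
  fixes g :: "real \<Rightarrow> real"
  assumes z: "nonneg_measure_I z" and g: "continuous_on unit_I g"
  shows "integrable z g"
proof -
  interpret finite_measure z by (rule finite_nonneg_measure_I[OF z])
  have "compact (g ` unit_I)" using g by (intro compact_continuous_image) auto
  then obtain B where B: "\<And>s. s \<in> unit_I \<Longrightarrow> norm (g s) \<le> B"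
    using compact_imp_bounded bounded_iff by (metis image_eqI)
  have "g \<in> borel_measurable z"
    using borel_measurable_continuous_on_restrict[OF g]
    by (simp add: measurable_cong_sets[OF sets_nonneg_measure_I[OF z] refl])
  moreover have "AE s in z. norm (g s) \<le> B"
    using B space_nonneg_measure_I[OF z] by (intro AE_I2) auto
  ultimately show ?thesis by (intro integrable_const_bound)
qed

lemma integral_gpoly:
  assumes "nonneg_measure_I z" "\<And>j. j \<in> {1..m} \<Longrightarrow> continuous_on unit_I (\<phi> j)"
  shows "(\<integral>s. gpoly m \<phi> b s \<partial>z) = (\<Sum>j\<in>{1..m}. b j * (\<integral>s. \<phi> j s \<partial>z))"
  using integrable_continuous_on_I[OF assms(1) assms(2)]
  by (subst Bochner_Integration.integral_sum) auto

lemma AE_supported_on: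
  assumes "nonneg_measure_I z" "supported_on z S" "S \<inter> unit_I \<in> sets borel_I"
  shows "AE s in z. s \<in> S"
proof (rule AE_I)
  note sp = space_nonneg_measure_I[OF assms(1)]
  show "{s \<in> space z. s \<notin> S} \<subseteq> space z - S" by auto
  show "emeasure z (space z - S) = 0" using assms(2) by (simp add: supported_on_def)
  have "space z - S = space z - (S \<inter> unit_I)" unfolding sp by auto
  also have "\<dots> \<in> sets z" using assms(3) sets_nonneg_measure_I[OF assms(1)] by (intro sets.Diff) auto
  finally show "space z - S \<in> sets z" .
qed

context separated_support
begin

lemma AE_on_support:
  assumes "nonneg_measure_I chi" "supported_on chi (t ` {1..k})"
  shows "AE s in chi. s \<in> t ` {1..k}"
proof (rule AE_supported_on[OF assms])
  have "t ` {1..k} \<inter> unit_I = unit_I \<inter> t ` {1..k}" by auto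
  moreover have "t ` {1..k} \<in> sets borel" by (intro borel_closed finite_imp_closed) simp
  ultimately show "t ` {1..k} \<inter> unit_I \<in> sets borel_I" by (auto simp: sets_restrict_space)
qed

text \<open>
  The part of \<open>F + F_sign \<pi>\<close> that carries information on the masses.
\<close>

definition signed_step :: "(nat \<Rightarrow> real) \<Rightarrow> real \<Rightarrow> real" where
  "signed_step \<pi> s = (if s \<in> nbhds k t \<epsilon> then \<pi> (nbhd_index k t \<epsilon> s) else 0)"

lemma signed_step_eq_sum: "signed_step \<pi> s = (\<Sum>i\<in>{1..k}. \<pi> i * indicator (region i) s)"
proof (cases "s \<in> nbhds k t \<epsilon>")
  case True
  let ?i = "nbhd_index k t \<epsilon> s"
  have i: "?i \<in> {1..k}" by (rule nbhd_index_props[OF True])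
  have "(\<Sum>i\<in>{1..k}. \<pi> i * indicator (region i) s) = (\<Sum>i\<in>{1..k}. if i = ?i then \<pi> i else 0)"
    using True by (intro sum.cong refl) (auto simp: region_def)
  also have "\<dots> = \<pi> ?i" using i by (simp add: sum.delta)
  finally show ?thesis using True by (simp add: signed_step_def)
next
  case False
  have "\<pi> i * indicator (region i) s = 0" for i using False by (simp add: region_def)
  then have "(\<Sum>i\<in>{1..k}. \<pi> i * indicator (region i) s) = 0" by (intro sum.neutral ballI)
  then show ?thesis using False by (simp add: signed_step_def)
qed

lemma integral_signed_step:
  assumes z: "nonneg_measure_I z"
  shows "integrable z (signed_step \<pi>)" "(\<integral>s. signed_step \<pi> s \<partial>z) = (\<Sum>i\<in>{1..k}. \<pi> i * measure z (region i))"
proof -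
  interpret finite_measure z by (rule finite_nonneg_measure_I[OF z])
  have R: "region i \<in> sets z" if "i \<in> {1..k}" for i
    using region_sets[OF that] sets_nonneg_measure_I[OF z] by simp
  have int: "integrable z (\<lambda>s. \<pi> i * indicator (region i) s)" if "i \<in> {1..k}" for i
    using R[OF that] by (intro integrable_mult_right integrable_real_indicator) (auto simp: less_top[symmetric])
  then show "integrable z (signed_step \<pi>)"
    unfolding signed_step_eq_sum[abs_def] by (rule Bochner_Integration.integrable_sum)
  have "(\<integral>s. signed_step \<pi> s \<partial>z) = (\<Sum>i\<in>{1..k}. \<integral>s. \<pi> i * indicator (region i) s \<partial>z)"
    unfolding signed_step_eq_sum using int by (rule Bochner_Integration.integral_sum)
  also have "\<dots> = (\<Sum>i\<in>{1..k}. \<pi> i * measure z (region i))"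
  proof (rule sum.cong[OF refl])
    fix i assume "i \<in> {1..k}"
    then have "region i \<inter> space z = region i" using sets.sets_into_space[OF R] by blast
    then show "(\<integral>s. \<pi> i * indicator (region i) s \<partial>z) = \<pi> i * measure z (region i)" by simp
  qed
  finally show "(\<integral>s. signed_step \<pi> s \<partial>z) = (\<Sum>i\<in>{1..k}. \<pi> i * measure z (region i))" .
qed

lemma measure_region_atom:
  assumes chi: "nonneg_measure_I chi" "supported_on chi (t ` {1..k})" and i: "i \<in> {1..k}"
  shows "measure chi (region i) = measure chi {t i}"
proof (rule measure_eq_AE)
  have "t i \<in> unit_I" using t_range[OF i] \<epsilon>_pos by auto
  then have "{t i} = unit_I \<inter> {t i}" by auto
  then show "{t i} \<in> sets chi"
    unfolding sets_nonneg_measure_I[OF chi(1)] sets_restrict_space by (intro image_eqI) auto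
  show "region i \<in> sets chi"
    unfolding sets_nonneg_measure_I[OF chi(1)] by (rule region_sets[OF i])
  have "s \<in> region i \<longleftrightarrow> s \<in> {t i}" if "s \<in> t ` {1..k}" for s
  proof -
    obtain j where j: "j \<in> {1..k}" "s = t j" using \<open>s \<in> t ` {1..k}\<close> by blast
    have "s \<in> nbhds k t \<epsilon>" unfolding j(2)
      by (rule in_nbhdsI[OF j(1) t_in_nbhd[OF j(1)]]) (use \<epsilon>_pos in simp)
    then have "s \<in> region i \<longleftrightarrow> j = i" using nbhd_index_t[OF j(1)] j(2) by (simp add: region_def)
    also have "\<dots> \<longleftrightarrow> s \<in> {t i}" using inj_onD[OF inj _ j(1) i] j(2) by auto
    finally show ?thesis .
  qed
  then show "AE s in chi. s \<in> region i \<longleftrightarrow> s \<in> {t i}"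
    using AE_on_support[OF chi] by auto
qed

text \<open>
  Only \<open>z\<close> contributes to the difference of the integrals, since \<open>q\<close> vanishes where \<open>chi\<close> lives.
\<close>

lemma off_support_mass:
  assumes z: "nonneg_measure_I z" and chi: "nonneg_measure_I chi" "supported_on chi (t ` {1..k})"
    and q: "continuous_on unit_I q" "\<And>s. s \<in> unit_I \<Longrightarrow> 0 \<le> q s"
      "\<And>s. s \<in> unit_I \<Longrightarrow> s \<notin> nbhds k t \<epsilon> \<Longrightarrow> c \<le> q s" "\<And>s. s \<in> t ` {1..k} \<Longrightarrow> q s = 0"
    and diff: "(\<integral>s. q s \<partial>z) - (\<integral>s. q s \<partial>chi) \<le> B"
  shows "c * measure z (unit_I - nbhds k t \<epsilon>) \<le> B"
proof -
  interpret finite_measure z by (rule finite_nonneg_measure_I[OF z])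
  note sz = sets_nonneg_measure_I[OF z] and sp = space_nonneg_measure_I[OF z]
  have "(\<integral>s. q s \<partial>chi) = (\<integral>s. 0 \<partial>chi)"
    using AE_on_support[OF chi] integrable_continuous_on_I[OF chi(1) q(1)] q(4)
    by (intro integral_cong_AE) (auto simp: borel_measurable_integrable)
  moreover have "c * measure z (unit_I - nbhds k t \<epsilon>) \<le> (\<integral>s. q s \<partial>z)"
  proof -
    have "nbhds k t \<epsilon> \<in> sets borel_I"
      unfolding Union_region[symmetric] using region_sets by (intro sets.finite_UN) auto
    then have A: "unit_I - nbhds k t \<epsilon> \<in> sets z" unfolding sz
      by (intro sets.Diff) (auto simp: sets_restrict_space)
    have "c * measure z (unit_I - nbhds k t \<epsilon>) = (\<integral>s. c * indicator (unit_I - nbhds k t \<epsilon>) s \<partial>z)"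
      using sets.sets_into_space[OF A] by (simp add: Int_absorb2)
    also have "\<dots> \<le> (\<integral>s. q s \<partial>z)"
    proof (rule integral_mono)
      show "integrable z (\<lambda>s. c * indicator (unit_I - nbhds k t \<epsilon>) s)"
        using A by (intro integrable_mult_right integrable_real_indicator) (auto simp: less_top[symmetric])
      show "integrable z q" by (rule integrable_continuous_on_I[OF z q(1)])
      show "c * indicator (unit_I - nbhds k t \<epsilon>) s \<le> q s" if "s \<in> space z" for s
        using that q(2,3) sp by (cases "s \<in> nbhds k t \<epsilon>") auto
    qed
    finally show ?thesis .
  qed
  ultimately show ?thesis using diff by simp
qed

text \<open>
  The comparison is one-sided: \<open>q\<close> and the step function have the same integral against \<open>chi\<close>, while
  \<open>q\<close> has the larger one against \<open>z\<close>.
\<close>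

lemma region_mass_difference:
  assumes z: "nonneg_measure_I z" and chi: "nonneg_measure_I chi" "supported_on chi (t ` {1..k})"
    and q: "continuous_on unit_I q" "\<And>s. s \<in> unit_I \<Longrightarrow> signed_step \<pi> s \<le> q s"
      "\<And>s. s \<in> t ` {1..k} \<Longrightarrow> q s = signed_step \<pi> s"
    and diff: "(\<integral>s. q s \<partial>z) - (\<integral>s. q s \<partial>chi) \<le> B"
  shows "(\<Sum>i\<in>{1..k}. \<pi> i * (measure z (region i) - measure chi {t i})) \<le> B"
proof -
  have "(\<integral>s. q s \<partial>chi) = (\<integral>s. signed_step \<pi> s \<partial>chi)"
    using AE_on_support[OF chi] integrable_continuous_on_I[OF chi(1) q(1)] integral_signed_step(1)[OF chi(1)] q(3)
    by (intro integral_cong_AE) (auto simp: borel_measurable_integrable)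
  moreover have "(\<integral>s. signed_step \<pi> s \<partial>z) \<le> (\<integral>s. q s \<partial>z)"
    using integral_signed_step(1)[OF z] integrable_continuous_on_I[OF z q(1)] q(2) space_nonneg_measure_I[OF z]
    by (intro integral_mono) auto
  ultimately have "(\<Sum>i\<in>{1..k}. \<pi> i * measure z (region i)) - (\<Sum>i\<in>{1..k}. \<pi> i * measure chi (region i)) \<le> B"
    using diff by (simp add: integral_signed_step(2)[OF z] integral_signed_step(2)[OF chi(1)])
  moreover have "(\<Sum>i\<in>{1..k}. \<pi> i * measure chi (region i)) = (\<Sum>i\<in>{1..k}. \<pi> i * measure chi {t i})"
    using measure_region_atom[OF chi] by (intro sum.cong) auto
  ultimately show ?thesis by (simp add: right_diff_distrib sum_subtractf)
qed

end

text \<open>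
  Both \<open>x_hat\<close> and \<open>chi\<close> match the data \<open>y\<close> up to \<open>\<delta>'\<close>, the latter by the Lipschitz condition.
\<close>

lemma moment_discrepancy:
  fixes x chi x_hat :: "real measure"
  assumes x: "nonneg_measure_I x" and chi: "nonneg_measure_I chi"
    and lipschitz: "lipschitz_GW m \<phi> L"
    and y: "\<And>j. j \<in> {1..m} \<Longrightarrow> y j = (\<integral>s. \<phi> j s \<partial>x) + \<eta> j"
    and noise: "0 \<le> \<delta>" "(\<Sum>j\<in>{1..m}. (\<eta> j)\<^sup>2) \<le> \<delta>\<^sup>2"
    and \<delta>': "\<delta>' = \<delta> + L * d_GW x chi"
    and x_hat: "L2_set (\<lambda>j. y j - (\<integral>s. \<phi> j s \<partial>x_hat)) {1..m} \<le> \<delta>'"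
  shows "L2_set (\<lambda>j. (\<integral>s. \<phi> j s \<partial>x_hat) - (\<integral>s. \<phi> j s \<partial>chi)) {1..m} \<le> 2 * \<delta>'"
proof -
  have "sqrt (\<Sum>j\<in>{1..m}. (\<eta> j)\<^sup>2) \<le> sqrt (\<delta>\<^sup>2)" by (rule real_sqrt_le_mono[OF noise(2)])
  then have "L2_set \<eta> {1..m} \<le> \<delta>" using noise(1) by (simp add: L2_set_def)
  moreover have "L2_set (\<lambda>j. (\<integral>s. \<phi> j s \<partial>x) - (\<integral>s. \<phi> j s \<partial>chi)) {1..m} \<le> L * d_GW x chi"
    using lipschitz x chi by (auto simp: lipschitz_GW_def)
  moreover have "L2_set (\<lambda>j. y j - (\<integral>s. \<phi> j s \<partial>chi)) {1..m}
      = L2_set (\<lambda>j. ((\<integral>s. \<phi> j s \<partial>x) - (\<integral>s. \<phi> j s \<partial>chi)) + \<eta> j) {1..m}"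
    using y by (intro L2_set_cong refl) simp
  ultimately have chi_close: "L2_set (\<lambda>j. y j - (\<integral>s. \<phi> j s \<partial>chi)) {1..m} \<le> \<delta>'"
    using L2_set_triangle_ineq[of "\<lambda>j. (\<integral>s. \<phi> j s \<partial>x) - (\<integral>s. \<phi> j s \<partial>chi)" \<eta> "{1..m}"] \<delta>' by simp
  have "L2_set (\<lambda>j. (\<integral>s. \<phi> j s \<partial>x_hat) - (\<integral>s. \<phi> j s \<partial>chi)) {1..m}
      = L2_set (\<lambda>j. (y j - (\<integral>s. \<phi> j s \<partial>chi)) - (y j - (\<integral>s. \<phi> j s \<partial>x_hat))) {1..m}"
    by (intro L2_set_cong refl) simp
  also have "\<dots> \<le> \<delta>' + \<delta>'"
    using L2_set_diff_le chi_close x_hat by (rule order_trans[OF _ add_mono])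
  finally show ?thesis by simp
qed

lemma gpoly_integral_difference:
  assumes z: "nonneg_measure_I z" "nonneg_measure_I w"
    and cont: "\<And>j. j \<in> {1..m} \<Longrightarrow> continuous_on unit_I (\<phi> j)"
    and close: "L2_set (\<lambda>j. (\<integral>s. \<phi> j s \<partial>z) - (\<integral>s. \<phi> j s \<partial>w)) {1..m} \<le> d"
  shows "(\<integral>s. gpoly m \<phi> b s \<partial>z) - (\<integral>s. gpoly m \<phi> b s \<partial>w) \<le> L2_set b {1..m} * d"
proof -
  have "(\<integral>s. gpoly m \<phi> b s \<partial>z) - (\<integral>s. gpoly m \<phi> b s \<partial>w)
      = (\<Sum>j\<in>{1..m}. b j * ((\<integral>s. \<phi> j s \<partial>z) - (\<integral>s. \<phi> j s \<partial>w)))"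
    by (simp only: integral_gpoly[OF z(1) cont] integral_gpoly[OF z(2) cont] right_diff_distrib sum_subtractf)
  also have "\<dots> \<le> L2_set b {1..m} * L2_set (\<lambda>j. (\<integral>s. \<phi> j s \<partial>z) - (\<integral>s. \<phi> j s \<partial>w)) {1..m}"
    by (rule sum_mult_le_L2_set)
  also have "\<dots> \<le> L2_set b {1..m} * d" by (intro mult_left_mono close L2_set_nonneg)
  finally show ?thesis .
qed

section \<open>The error bound\<close>

theorem theorem11:
  fixes x chi x_hat :: "real measure"
    and \<phi> :: "nat \<Rightarrow> real \<Rightarrow> real"
    and m k :: nat
    and t y \<eta> :: "nat \<Rightarrow> real"
    and f :: "real \<Rightarrow> real"
    and L \<delta> \<delta>' \<epsilon> fbar f0 f1 :: real
  assumes x: "nonneg_measure_I x" "supported_on x {0<..<1}"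
    and \<phi>_cont: "\<And>j. j \<in> {1..m} \<Longrightarrow> continuous_on unit_I (\<phi> j)"
    and lipschitz: "lipschitz_GW m \<phi> L"
    and y: "\<And>j. j \<in> {1..m} \<Longrightarrow> y j = (\<integral>s. \<phi> j s \<partial>x) + \<eta> j"
    and noise: "0 \<le> \<delta>" "(\<Sum>j\<in>{1..m}. (\<eta> j)\<^sup>2) \<le> \<delta>\<^sup>2"
    and t: "inj_on t {1..k}" "t ` {1..k} \<subseteq> {0<..<1}"
    and chi: "nonneg_measure_I chi" "supported_on chi (t ` {1..k})"
    and \<epsilon>: "0 < \<epsilon>" "\<epsilon> \<le> min_sep (t ` {1..k}) / 2"
    and f: "bounded (range f)" "\<And>s. 0 \<le> f s" "f 0 = 0"
    and f_consts: "0 < fbar" "0 < f0" "0 < f1"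
    and m: "2 * k + 2 \<le> m"
    and T_sys: "T_system m \<phi>"
    and T_star: "T_star_system k t m (\<phi>(0 := sep_F k t \<epsilon> f fbar f0 f1))"
    and T_star_sign: "\<And>\<pi>. \<pi> \<in> sign_patterns k \<Longrightarrow>
           T_star_system k t m (\<phi>(0 := sep_F_sign k t \<epsilon> f fbar f0 f1 \<pi>))"
    and \<delta>': "\<delta>' = \<delta> + L * d_GW x chi"
    and x_hat: "nonneg_measure_I x_hat"
      "L2_set (\<lambda>j. y j - (\<integral>s. \<phi> j s \<partial>x_hat)) {1..m} \<le> \<delta>'"
  shows "\<exists>(b :: nat \<Rightarrow> real) (b_sign :: (nat \<Rightarrow> real) \<Rightarrow> nat \<Rightarrow> real).
      (\<forall>s\<in>unit_I. (\<Sum>j\<in>{1..m}. b j * \<phi> j s) \<ge> sep_F k t \<epsilon> f fbar f0 f1 s) \<and>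
      (\<forall>s\<in>t ` {1..k}. (\<Sum>j\<in>{1..m}. b j * \<phi> j s) = sep_F k t \<epsilon> f fbar f0 f1 s) \<and>
      (\<forall>\<pi>\<in>sign_patterns k.
         (\<forall>s\<in>unit_I. (\<Sum>j\<in>{1..m}. b_sign \<pi> j * \<phi> j s)
                        \<ge> sep_F_sign k t \<epsilon> f fbar f0 f1 \<pi> s) \<and>
         (\<forall>s\<in>t ` {1..k}. (\<Sum>j\<in>{1..m}. b_sign \<pi> j * \<phi> j s)
                        = sep_F_sign k t \<epsilon> f fbar f0 f1 \<pi> s)) \<and>
      d_GW x x_hat \<le>
        ((6 + 2 / fbar) * L2_set b {1..m}
           + 6 * Min ((\<lambda>\<pi>. L2_set (b_sign \<pi>) {1..m}) ` sign_patterns k)) * \<delta>'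
        + \<epsilon> * tv_norm (measure chi) + d_GW x chi"
proof -
  interpret S: dual_separators k t \<epsilon> m \<phi> f fbar f0 f1
    by unfold_locales (fact t \<epsilon> T_sys m f(2,3) f_consts)+
  let ?F = "sep_F k t \<epsilon> f fbar f0 f1" and ?F\<pi> = "sep_F_sign k t \<epsilon> f fbar f0 f1"
  let ?SP = "sign_patterns k" and ?T = "t ` {1..k}"
  have exist: "(\<exists>b. (\<forall>s\<in>?T. gpoly m \<phi> b s = ?F s) \<and> (\<forall>s\<in>unit_I. ?F s \<le> gpoly m \<phi> b s)) \<and>
    (\<forall>\<pi>\<in>?SP. \<exists>b. (\<forall>s\<in>?T. gpoly m \<phi> b s = ?F\<pi> \<pi> s) \<and> (\<forall>s\<in>unit_I. ?F\<pi> \<pi> s \<le> gpoly m \<phi> b s))"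
    by (rule S.dual_polynomials_exist[OF T_star T_star_sign])
  obtain b where b_eq: "\<forall>s\<in>?T. gpoly m \<phi> b s = ?F s" and b_ge: "\<forall>s\<in>unit_I. ?F s \<le> gpoly m \<phi> b s"
    using conjunct1[OF exist] by (elim exE conjE) (rule that)
  obtain a where a: "\<forall>\<pi>\<in>?SP. (\<forall>s\<in>?T. gpoly m \<phi> (a \<pi>) s = ?F\<pi> \<pi> s)
      \<and> (\<forall>s\<in>unit_I. ?F\<pi> \<pi> s \<le> gpoly m \<phi> (a \<pi>) s)"
    using bchoice[OF conjunct2[OF exist]] by (elim exE) (rule that)
  let ?n = "\<lambda>c. L2_set c {1..m}"
  have F_nonneg: "0 \<le> ?F s" for s by (rule S.F_nonneg)
  have F_t: "?F s = 0" if "s \<in> ?T" for s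
    using that S.F_at_t(1) by blast
  have cont: "continuous_on unit_I (gpoly m \<phi> c)" for c
    by (rule continuous_on_gpoly[OF \<phi>_cont])
  have \<delta>'_nonneg: "0 \<le> \<delta>'" by (rule order_trans[OF L2_set_nonneg x_hat(2)])

  have close: "?n (\<lambda>j. (\<integral>s. \<phi> j s \<partial>x_hat) - (\<integral>s. \<phi> j s \<partial>chi)) \<le> 2 * \<delta>'"
    by (rule moment_discrepancy[OF x(1) chi(1) lipschitz y noise \<delta>' x_hat(2)])
  have pairing: "(\<integral>s. gpoly m \<phi> c s \<partial>x_hat) - (\<integral>s. gpoly m \<phi> c s \<partial>chi) \<le> ?n c * (2 * \<delta>')" for c
    by (rule gpoly_integral_difference[OF x_hat(1) chi(1) \<phi>_cont close])

  have off: "fbar * measure x_hat (unit_I - nbhds k t \<epsilon>) \<le> ?n b * (2 * \<delta>')"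
  proof (rule S.off_support_mass[OF x_hat(1) chi cont _ _ _ pairing])
    show "0 \<le> gpoly m \<phi> b s" if "s \<in> unit_I" for s
      using F_nonneg[of s] bspec[OF b_ge that] by linarith
    show "fbar \<le> gpoly m \<phi> b s" if "s \<in> unit_I" "s \<notin> nbhds k t \<epsilon>" for s
      by (rule S.gpoly_ge_fbar[OF bspec[OF b_ge] that])
    show "gpoly m \<phi> b s = 0" if "s \<in> ?T" for s
      using bspec[OF b_eq that] F_t[OF that] by linarith
  qed

  \<comment> \<open>The signs of the local mass differences turn the signed sum into a sum of absolute values.\<close>
  define \<pi> where "\<pi> = (\<lambda>i\<in>{1..k}. if measure chi {t i} \<le> measure x_hat (S.region i) then 1 else - 1 :: real)"
  have \<pi>: "\<pi> \<in> ?SP" by (auto simp: \<pi>_def sign_patterns_def)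
  let ?q = "\<lambda>j. a \<pi> j + 1 * b j"
  note a\<pi> = bspec[OF a \<pi>]
  have on: "(\<Sum>i\<in>{1..k}. \<bar>measure chi {t i} - measure x_hat (S.region i)\<bar>) \<le> (?n (a \<pi>) + ?n b) * (2 * \<delta>')"
  proof -
    have "(\<Sum>i\<in>{1..k}. \<pi> i * (measure x_hat (S.region i) - measure chi {t i})) \<le> ?n ?q * (2 * \<delta>')"
    proof (rule S.region_mass_difference[OF x_hat(1) chi cont _ _ pairing])
      show "S.signed_step \<pi> s \<le> gpoly m \<phi> ?q s" if s: "s \<in> unit_I" for s
      proof -
        have "S.signed_step \<pi> s \<le> ?F s + ?F\<pi> \<pi> s"
          unfolding S.signed_step_def by (rule S.F_add_F_sign[OF s])
        also have "\<dots> \<le> gpoly m \<phi> ?q s"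
          using bspec[OF b_ge s] bspec[OF conjunct2[OF a\<pi>] s] by (simp only: gpoly_add_scaled)
        finally show ?thesis .
      qed
      show "gpoly m \<phi> ?q s = S.signed_step \<pi> s" if s: "s \<in> ?T" for s
      proof -
        obtain i where i: "i \<in> {1..k}" "s = t i" using s by blast
        have "s \<in> nbhds k t \<epsilon>" unfolding i(2)
          by (rule in_nbhdsI[OF i(1) S.t_in_nbhd[OF i(1)]]) (use \<epsilon>(1) in simp)
        then have "S.signed_step \<pi> s = \<pi> i" using S.nbhd_index_t[OF i(1)] i(2) by (simp add: S.signed_step_def)
        moreover have "?F\<pi> \<pi> s = \<pi> i"
          unfolding i(2) by (rule S.F_at_t(2)[OF i(1)])
        ultimately show ?thesis
          using bspec[OF b_eq s] bspec[OF conjunct1[OF a\<pi>] s] F_t[OF s] by (simp only: gpoly_add_scaled)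
      qed
    qed
    also have "\<dots> \<le> (?n (a \<pi>) + ?n b) * (2 * \<delta>')"
      using L2_set_triangle_ineq[of "a \<pi>" b "{1..m}"] \<delta>'_nonneg by (intro mult_right_mono) auto
    also have "(\<Sum>i\<in>{1..k}. \<pi> i * (measure x_hat (S.region i) - measure chi {t i}))
        = (\<Sum>i\<in>{1..k}. \<bar>measure chi {t i} - measure x_hat (S.region i)\<bar>)"
      by (intro sum.cong refl) (auto simp: \<pi>_def)
    finally show ?thesis .
  qed

  have bound: "d_GW x x_hat \<le> ((2 + 2 / fbar) * ?n b + 2 * ?n (a \<pi>)) * \<delta>'
      + \<epsilon> * tv_norm (measure chi) + d_GW x chi"
  proof -
    have "d_GW x x_hat \<le> d_GW x chi + \<epsilon> * measure chi unit_I
      + (\<Sum>i\<in>{1..k}. \<bar>measure chi {t i} - measure x_hat (S.region i)\<bar>)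
      + measure x_hat (unit_I - (\<Union>i\<in>{1..k}. S.region i))"
    proof (rule d_GW_through_atoms[OF x(1) chi(1) x_hat(1) t(1) _ S.region_sets S.disjoint_region _ _ chi(2)])
      show "?T \<subseteq> unit_I" using t(2) by auto
      show "\<bar>t i - v\<bar> \<le> \<epsilon>" if "v \<in> S.region i" for i v
        using subsetD[OF S.region_subset that] by (simp add: nbhd_def abs_minus_commute)
    qed (use \<epsilon>(1) in simp_all)
    moreover have "measure x_hat (unit_I - nbhds k t \<epsilon>) \<le> ?n b * (2 * \<delta>') / fbar"
      using off f_consts(1) by (simp add: field_simps)
    ultimately have "d_GW x x_hat \<le> d_GW x chi + \<epsilon> * tv_norm (measure chi)
        + (?n (a \<pi>) + ?n b) * (2 * \<delta>') + ?n b * (2 * \<delta>') / fbar"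
      using on unfolding S.Union_region tv_norm_measure[OF chi(1)] by linarith
    then show ?thesis by (simp add: algebra_simps)
  qed

  have n_pos: "0 < ?n b"
  proof -
    have "?n b \<noteq> 0"
    proof
      assume "?n b = 0"
      then have "\<forall>j\<in>{1..m}. b j = 0" by (simp add: L2_set_eq_0_iff)
      then have "gpoly m \<phi> b 0 = 0" by simp
      then show False using bspec[OF b_ge, of 0] f_consts(2) by (simp add: sep_F_def)
    qed
    then show ?thesis using L2_set_nonneg[of b "{1..m}"] by linarith
  qed
  have fin: "finite ?SP" by (simp add: sign_patterns_def finite_PiE)
  \<comment> \<open>Adding a multiple of \<open>q\<close> to every \<open>q\<^sup>\<pi>\<close> makes all norms at least as large as the one in the estimate.\<close>
  define R where "R = Max ((\<lambda>\<pi>. ?n (a \<pi>)) ` ?SP)"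
  have R: "?n (a \<sigma>) \<le> R" if "\<sigma> \<in> ?SP" for \<sigma>
    unfolding R_def using fin that by (intro Max_ge) auto
  have R_nonneg: "0 \<le> R" using R[OF \<pi>] L2_set_nonneg order_trans by blast
  \<comment> \<open>The triangle inequality loses at most \<open>R\<close>, so \<open>2 * R\<close> leaves a norm of at least \<open>R\<close>.\<close>
  define c where "c = 2 * R / ?n b"
  have c: "0 \<le> c" "c * ?n b = 2 * R" using n_pos R_nonneg by (simp_all add: c_def)
  define b_sign where "b_sign \<sigma> j = a \<sigma> j + c * b j" for \<sigma> j
  have large: "R \<le> ?n (b_sign \<sigma>)" if "\<sigma> \<in> ?SP" for \<sigma>
  proof -
    have "2 * R = ?n (\<lambda>j. b_sign \<sigma> j - a \<sigma> j)"
      using c L2_set_right_distrib[of c b "{1..m}"] by (simp add: b_sign_def)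
    also have "\<dots> \<le> ?n (b_sign \<sigma>) + ?n (a \<sigma>)" by (rule L2_set_diff_le)
    finally show ?thesis using R[OF that] by linarith
  qed
  have Min: "?n (a \<pi>) \<le> Min ((\<lambda>\<sigma>. ?n (b_sign \<sigma>)) ` ?SP)"
  proof -
    have "R \<le> Min ((\<lambda>\<sigma>. ?n (b_sign \<sigma>)) ` ?SP)"
      using fin \<pi> large by (intro Min.boundedI) auto
    then show ?thesis using R[OF \<pi>] by linarith
  qed
  have b_sign_gpoly: "gpoly m \<phi> (b_sign \<sigma>) s = gpoly m \<phi> (a \<sigma>) s + c * gpoly m \<phi> b s" for \<sigma> s
    unfolding b_sign_def by (rule gpoly_add_scaled)
  have final: "d_GW x x_hat \<le> ((6 + 2 / fbar) * ?n b + 6 * Min ((\<lambda>\<sigma>. ?n (b_sign \<sigma>)) ` ?SP)) * \<delta>'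
        + \<epsilon> * tv_norm (measure chi) + d_GW x chi"
  proof -
    have "(2 + 2 / fbar) * ?n b + 2 * ?n (a \<pi>) \<le> (6 + 2 / fbar) * ?n b + 6 * Min ((\<lambda>\<sigma>. ?n (b_sign \<sigma>)) ` ?SP)"
      using Min n_pos L2_set_nonneg[of "a \<pi>" "{1..m}"] unfolding distrib_right by linarith
    from mult_right_mono[OF this \<delta>'_nonneg] bound show ?thesis by linarith
  qed
  show ?thesis
  proof (intro exI[of _ b] exI[of _ b_sign] conjI ballI)
    fix s assume s: "s \<in> unit_I"
    show "?F s \<le> gpoly m \<phi> b s" by (rule bspec[OF b_ge s])
  next
    fix s assume s: "s \<in> ?T"
    show "gpoly m \<phi> b s = ?F s" by (rule bspec[OF b_eq s])
  next
    fix \<sigma> s assume \<sigma>: "\<sigma> \<in> ?SP" and s: "s \<in> unit_I"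
    have "0 \<le> c * gpoly m \<phi> b s"
      by (rule mult_nonneg_nonneg[OF c(1) order_trans[OF F_nonneg bspec[OF b_ge s]]])
    then show "?F\<pi> \<sigma> s \<le> gpoly m \<phi> (b_sign \<sigma>) s"
      unfolding b_sign_gpoly using bspec[OF conjunct2[OF bspec[OF a \<sigma>]] s] by linarith
  next
    fix \<sigma> s assume \<sigma>: "\<sigma> \<in> ?SP" and s: "s \<in> ?T"
    show "gpoly m \<phi> (b_sign \<sigma>) s = ?F\<pi> \<sigma> s"
      unfolding b_sign_gpoly bspec[OF b_eq s] F_t[OF s]
      using bspec[OF conjunct1[OF bspec[OF a \<sigma>]] s] by simp
  qed (fact final)
qed

end
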